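(* Let $n>1$ be an integer, let $p_n(z)=z(z^n-1)$, and let $C_n$ be Chebyshev's method applied to $p_n$. If $n\le 16$ or $n$ is odd, then $C_n$ is convergent, i.e. the Fatou set of $C_n$ is the union of the basins of attraction (under $C_n$) of the roots of $p_n$.
   Context: Chebyshev's method applied to a polynomial $p$ is the rational map $C_p(z)=z-\left(1+\frac12 L_p(z)\right)\frac{p(z)}{p'(z)}$, where $L_p(z)=\frac{p(z)p''(z)}{(p'(z))^2}$, viewed as a self-map of the Riemann sphere $\widehat{\mathbb C}$. For $p_n(z)=z(z^n-1)$ one has $C_n(z)=\frac{z^{n+1}\left(n(n+1)(2n+1)z^{2n}-2n(n+1)z^n-n(n-1)\right)}{2\left((n+1)z^n-1\right)^3}$. The roots of $p_n$ are superattracting fixed points of $C_n$. The Fatou set of a rational map $R$ is the maximal open subset of $\widehat{\mathbb C}$ on which the family of iterates $\{R^m: m\in\mathbb N\}$ is equicontinuous. The basin of attraction of an attracting fixed point $z_0$ of $C_n$ is $\{z\in\widehat{\mathbb C}:\lim_{m\to\infty}C_n^m(z)=z_0\}$, where $C_n^m$ is the $m$-fold iterate. A root-finding method $F_p$ is called convergent for $p$ if its Fatou set consists entirely of the basins of attraction of the roots of $p$. *)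

theory Defs
  imports
    "HOL-Analysis.Analysis"
    "HOL-Computational_Algebra.Computational_Algebra"
    "HOL-Computational_Algebra.Field_as_Ring"
begin

datatype riemann_sphere = Fin complex | Infty

text \<open>
  Inverse stereographic projection onto the unit sphere of \<open>\<complex> \<times> \<real>\<close>, with the point at infinity
  sent to the north pole. The metric on the sphere is the chordal one obtained from it, so
  \<open>dist (Fin z) (Fin w) = 2 * cmod (z - w) / sqrt ((1 + (cmod z)\<^sup>2) * (1 + (cmod w)\<^sup>2))\<close>.
\<close>

fun stereo :: "riemann_sphere \<Rightarrow> complex \<times> real" where
  "stereo (Fin z) =
     ((2 / ((cmod z)\<^sup>2 + 1)) *\<^sub>R z, ((cmod z)\<^sup>2 - 1) / ((cmod z)\<^sup>2 + 1))"
| "stereo Infty = (0, 1)"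

lemma norm_sq_plus_1_neq_0: "(cmod z)\<^sup>2 + 1 \<noteq> 0"
  by (metis add.commute add_cancel_right_right sum_power2_eq_zero_iff one_power2 zero_neq_one)

lemma inj_stereo: "inj stereo"
proof (rule injI)
  have north: "((cmod z)\<^sup>2 - 1) / ((cmod z)\<^sup>2 + 1) \<noteq> 1" for z
    using norm_sq_plus_1_neq_0[of z] by (auto simp: field_simps)
  fix p q assume eq: "stereo p = stereo q"
  show "p = q"
  proof (cases p; cases q)
    fix z w assume pq: "p = Fin z" "q = Fin w"
    define s where "s = (cmod z)\<^sup>2 + 1"
    define t where "t = (cmod w)\<^sup>2 + 1"
    have st: "s \<noteq> 0" "t \<noteq> 0"
      using norm_sq_plus_1_neq_0 by (auto simp: s_def t_def)
    have "(s - 2) / s = (t - 2) / t"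
      using eq by (simp add: pq s_def t_def)
    then have "s = t"
      using st by (simp add: field_simps)
    moreover have "(2 / s) *\<^sub>R z = (2 / t) *\<^sub>R w"
      using eq by (simp add: pq s_def t_def)
    ultimately show "p = q"
      using st pq by simp
  qed (use eq north in \<open>auto dest: sym\<close>)
qed

instantiation riemann_sphere :: metric_space
begin

definition dist_riemann_sphere :: "riemann_sphere \<Rightarrow> riemann_sphere \<Rightarrow> real" where
  "dist (p :: riemann_sphere) q = dist (stereo p) (stereo q)"

definition uniformity_riemann_sphere :: "(riemann_sphere \<times> riemann_sphere) filter" where
  "(uniformity :: (riemann_sphere \<times> riemann_sphere) filter) =
     (INF e\<in>{0 <..}. principal {(p, q). dist p q < e})"

definition open_riemann_sphere :: "riemann_sphere set \<Rightarrow> bool" where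
  "open (U :: riemann_sphere set) \<longleftrightarrow>
     (\<forall>p\<in>U. eventually (\<lambda>(p', q). p' = p \<longrightarrow> q \<in> U) uniformity)"

instance
proof
  show "dist p q = 0 \<longleftrightarrow> p = q" for p q :: riemann_sphere
    by (auto simp: dist_riemann_sphere_def dest: injD[OF inj_stereo])
  show "dist p q \<le> dist p r + dist q r" for p q r :: riemann_sphere
    unfolding dist_riemann_sphere_def by (rule dist_triangle2)
qed (simp_all only: uniformity_riemann_sphere_def open_riemann_sphere_def)

end

text \<open>
  A rational function as a self-map of the sphere. Since \<open>quot_of_fract\<close> yields a coprime
  numerator and denominator, a zero of the denominator is a pole.
\<close>

definition sphere_map :: "complex poly fract \<Rightarrow> riemann_sphere \<Rightarrow> riemann_sphere" where
  "sphere_map f x = (let (a, b) = quot_of_fract f in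
     case x of
       Fin z \<Rightarrow> if poly b z = 0 then Infty else Fin (poly a z / poly b z)
     | Infty \<Rightarrow> if degree b < degree a then Infty
                else Fin (coeff a (degree b) / coeff b (degree b)))"

definition equicontinuous_family_on ::
    "'a::metric_space set \<Rightarrow> ('a \<Rightarrow> 'b::metric_space) set \<Rightarrow> bool" where
  "equicontinuous_family_on U \<F> \<longleftrightarrow>
     (\<forall>x\<in>U. \<forall>e>0. \<exists>d>0. \<forall>y\<in>U. dist y x < d \<longrightarrow> (\<forall>f\<in>\<F>. dist (f y) (f x) < e))"

definition iterates :: "('a \<Rightarrow> 'a) \<Rightarrow> ('a \<Rightarrow> 'a) set" where
  "iterates R = range (\<lambda>m. R ^^ m)"

definition fatou_set :: "('a::metric_space \<Rightarrow> 'a) \<Rightarrow> 'a set" where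
  "fatou_set R = \<Union>{U. open U \<and> equicontinuous_family_on U (iterates R)}"

lemma fatou_set_greatest:
  "open (fatou_set R)"
  "equicontinuous_family_on (fatou_set R) (iterates R)"
  "open U \<Longrightarrow> equicontinuous_family_on U (iterates R) \<Longrightarrow> U \<subseteq> fatou_set R"
proof -
  show "open (fatou_set R)"
    by (auto simp: fatou_set_def)
  show "U \<subseteq> fatou_set R" if "open U" "equicontinuous_family_on U (iterates R)" for U
    using that by (auto simp: fatou_set_def)
  show "equicontinuous_family_on (fatou_set R) (iterates R)"
    unfolding equicontinuous_family_on_def
  proof (intro ballI allI impI)
    fix x and e :: real assume "x \<in> fatou_set R" and e: "e > 0"
    then obtain U where U: "open U" "equicontinuous_family_on U (iterates R)" "x \<in> U"
      by (auto simp: fatou_set_def)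
    obtain d1 where d1: "d1 > 0" "\<forall>y\<in>U. dist y x < d1 \<longrightarrow> (\<forall>f\<in>iterates R. dist (f y) (f x) < e)"
      using U(2,3) e unfolding equicontinuous_family_on_def by blast
    obtain d2 where d2: "d2 > 0" "\<forall>y. dist y x < d2 \<longrightarrow> y \<in> U"
      using U(1,3) unfolding open_dist by blast
    show "\<exists>d>0. \<forall>y\<in>fatou_set R. dist y x < d \<longrightarrow> (\<forall>f\<in>iterates R. dist (f y) (f x) < e)"
      using d1 d2 by (intro exI[of _ "min d1 d2"]) auto
  qed
qed

definition basin :: "('a::metric_space \<Rightarrow> 'a) \<Rightarrow> 'a \<Rightarrow> 'a set" where
  "basin R z0 = {z. (\<lambda>m. (R ^^ m) z) \<longlonglongrightarrow> z0}"

definition convergent_for :: "(complex poly \<Rightarrow> complex poly fract) \<Rightarrow> complex poly \<Rightarrow> bool" where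
  "convergent_for F p \<longleftrightarrow>
     fatou_set (sphere_map (F p)) = (\<Union>r\<in>{r. poly p r = 0}. basin (sphere_map (F p)) (Fin r))"

definition chebyshev_L :: "complex poly \<Rightarrow> complex poly fract" where
  "chebyshev_L p = to_fract p * to_fract (pderiv (pderiv p)) / (to_fract (pderiv p))\<^sup>2"

definition chebyshev :: "complex poly \<Rightarrow> complex poly fract" where
  "chebyshev p =
     to_fract [:0, 1:] - (1 + 1 / 2 * chebyshev_L p) * (to_fract p / to_fract (pderiv p))"

definition p_poly :: "nat \<Rightarrow> complex poly" where
  "p_poly n = [:0, 1:] * ([:0, 1:] ^ n - 1)"

end

theory Submission
  imports Defs "HOL-Complex_Analysis.Complex_Analysis"
begin

text \<open>
  Work in the coordinate \<open>u = 1 / z\<close> and put \<open>v = u ^ n\<close>. Chebyshev's map becomes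
  \<open>f u = u * 2 * (n + 1 - v) ^ 3 / (n * ((n + 1) * (2 * n + 1) - 2 * (n + 1) * v - (n - 1) * v\<^sup>2))\<close>.
  The root \<open>z = 0\<close> has moved to \<open>u = \<infinity>\<close>, and the old point at infinity has become \<open>u = 0\<close>, a repelling
  fixed point. The critical points in the plane are the roots of unity, the points \<open>v = n + 1\<close>, which
  are mapped to \<open>0\<close>, and the free critical points \<open>v = - (n + 1) * (2 * n + 1) / (n - 1)\<close>. The theorem holds
  because the free critical points lie in the basins of the roots, so that no critical point is left for
  any other kind of Fatou component.

  The last step is usually taken from the classification of Fatou components together with the absence of
  wandering domains. The following argument needs neither. The basins belong to the Fatou set because the
  roots are superattracting. A point outside the basins keeps its orbit away from the roots; if the basins
  are dense, arbitrarily close points have orbits that tend to a root, so the iterates are not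
  equicontinuous there (\<open>fatou_set_eq_basins\<close>). It remains to see that the complement \<open>K\<close> of the basins has
  empty interior (\<open>interior_K_empty\<close>).

  Remove from the plane a neighbourhood of infinity, the roots of unity, the orbits of the free critical
  points and the point \<open>0\<close>. Over the resulting bounded set \<open>\<Omega>\<close> the map \<open>f\<close> is a covering, so every iterate
  has all its inverse branches on discs in \<open>\<Omega>\<close>, and these form a normal family. Call a point of \<open>\<Omega>\<close>
  unexpanded if some sequence of inverse branches of higher and higher iterates has a nonconstant limit near
  it. Continuing branches shows that these points form an open and closed subset of the plane punctured at
  \<open>0\<close>. They all lie in \<open>K\<close>, because a nonconstant limit near a point of a basin would force an orbit to
  return to a neighbourhood of that point infinitely often. As \<open>K\<close> is bounded, there are no unexpanded points. On the other
  hand, the iterates have bounded derivatives at an interior point of \<open>K\<close>, its orbit cannot stay close to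
  the repelling point \<open>0\<close>, and the inverse branches that lead back to it converge to a nonconstant limit at
  an accumulation point of the orbit. So there is no interior point.

  For the free critical points \<open>v\<close> is real and remains real, which leaves an interval map. If \<open>n\<close> is even and
  at most \<open>16\<close>, the orbit stays on the negative half-line and \<open>f\<close> expands it there, so it tends to \<open>u = \<infinity>\<close>.
  If \<open>n\<close> is odd, the first image has \<open>v > 0\<close>: for \<open>n \<le> 15\<close> it is so large that the orbit tends to \<open>u = \<infinity>\<close>, and
  for \<open>n \<ge> 17\<close> the orbit enters an interval on which it converges monotonically to \<open>v = 1\<close>, that is, to a root
  of unity.
\<close>

section \<open>Compact invariant sets without interior\<close>

text \<open>
  The setting abstracts a rational map near the complement \<open>K\<close> of its attracting basins. Think of
  \<open>\<Omega>\<close> as the plane without the closure of the postcritical set, so that \<open>f\<close> is an unbranched covering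
  over \<open>\<Omega>\<close>. The only point of \<open>K\<close> missing from \<open>\<Omega>\<close> is a repelling fixed point \<open>a\<close>, which may be a
  critical value. The attracting points lie outside \<open>\<Omega>\<close>, so convergence to one of them appears as
  \<open>escape\<close> from every compact subset of \<open>\<Omega>\<close>.
\<close>

locale covering_dynamics =
  fixes f :: "complex \<Rightarrow> complex" and \<Omega> K :: "complex set" and a :: complex
  assumes open_Omega: "open \<Omega>" and bounded_Omega: "bounded \<Omega>"
    and open_preimage: "open (f -` \<Omega>)" and preimage_subset: "f -` \<Omega> \<subseteq> \<Omega>"
    and covering: "covering_space (f -` \<Omega>) f \<Omega>"
    and holomorphic_preimage: "f holomorphic_on f -` \<Omega>"
    and compact_K: "compact K" and image_K: "f ` K \<subseteq> K" and K_subset: "K \<subseteq> insert a \<Omega>"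
    and analytic_K: "f analytic_on K"
    and escape: "\<And>x L. x \<in> \<Omega> \<Longrightarrow> x \<notin> K \<Longrightarrow> compact L \<Longrightarrow> L \<subseteq> \<Omega> \<Longrightarrow>
                   eventually (\<lambda>m. (f ^^ m) x \<notin> L) sequentially"
    and a_in_K: "a \<in> K" and a_notin_Omega: "a \<notin> \<Omega>" and fixed_a: "f a = a"
    and repelling_a: "norm (deriv f a) > 1"
    and finite_fibre_a: "finite {x \<in> K. f x = a}"
begin

lemma iterate_in_K: "x \<in> K \<Longrightarrow> (f ^^ m) x \<in> K"
  using image_K by (induction m) auto

lemma iterate_analytic_K: "(f ^^ m) analytic_on K"
proof (induction m)
  case (Suc m)
  have "f analytic_on ((f ^^ m) ` K)"
    using iterate_in_K by (intro analytic_on_subset[OF analytic_K]) auto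
  then show ?case
    using analytic_on_compose[OF Suc, of f] by (simp add: o_def)
qed (simp add: id_def analytic_on_ident)

lemma iterate_preimage: "(f ^^ m) x \<in> \<Omega> \<Longrightarrow> x \<in> \<Omega>"
  using preimage_subset by (induction m) auto

text \<open>
  Near an interior point all iterates take values in the bounded set \<open>K\<close>, so Cauchy's estimate applies.
\<close>

lemma iterate_deriv_bounded:
  assumes "x \<in> interior K"
  obtains C where "C > 0" "\<And>m. norm (deriv (f ^^ m) x) \<le> C"
proof -
  obtain r where r: "r > 0" "cball x r \<subseteq> K"
    using assms by (meson mem_interior_cball)
  obtain B where B: "B > 0" "K \<subseteq> ball 0 B"
    using compact_K bounded_subset_ballD[OF compact_imp_bounded, of K 0] by auto
  show thesis
  proof
    show "B / r > 0"
      using r B by simp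
    fix m
    have "(f ^^ m) analytic_on cball x r"
      using iterate_analytic_K r(2) analytic_on_subset by blast
    then have hol: "(f ^^ m) holomorphic_on cball x r"
      by (rule analytic_imp_holomorphic)
    have "norm ((deriv ^^ 1) (f ^^ m) x) \<le> fact 1 * B / r ^ 1"
    proof (rule Cauchy_higher_deriv_bound)
      show "(f ^^ m) holomorphic_on ball x r"
        using hol holomorphic_on_subset ball_subset_cball by blast
      show "continuous_on (cball x r) (f ^^ m)"
        using hol holomorphic_on_imp_continuous_on by blast
      show "(f ^^ m) w \<in> ball 0 B" if "w \<in> ball x r" for w
        using that r B iterate_in_K[of w m] by (auto simp: subset_iff)
    qed (use r in auto)
    then show "norm (deriv (f ^^ m) x) \<le> B / r"
      by simp
  qed
qed

lemma iterate_fixed: "(f ^^ m) a = a"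
  using fixed_a by (induction m) auto

lemma f_differentiable_a: "(f has_field_derivative deriv f a) (at a)"
  using analytic_K a_in_K
  by (meson analytic_on_imp_differentiable_at DERIV_deriv_iff_field_differentiable)

text \<open>
  The derivatives of the iterates at \<open>a\<close> are the powers of its multiplier, and these are unbounded.
\<close>

lemma a_notin_interior: "a \<notin> interior K"
proof
  assume "a \<in> interior K"
  then obtain C where C: "\<And>m. norm (deriv (f ^^ m) a) \<le> C"
    using iterate_deriv_bounded by metis
  have D: "((f ^^ m) has_field_derivative deriv f a ^ m) (at a)" for m
  proof (induction m)
    case (Suc m)
    have "(f has_field_derivative deriv f a) (at ((f ^^ m) a))"
      using f_differentiable_a by (simp add: iterate_fixed)
    from DERIV_chain[OF this Suc] show ?case
      by (simp add: o_def)
  qed (auto simp: id_def)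
  have "norm (deriv f a) ^ m \<le> C" for m
    using C[of m] DERIV_imp_deriv[OF D[of m]] by (simp add: norm_power)
  then show False
    using repelling_a by (meson not_le real_arch_pow)
qed

text \<open>
  By the open mapping theorem it suffices that \<open>f\<close> is not constant near a point of \<open>K\<close>: the fibre over
  \<open>a\<close> is finite, and elsewhere \<open>f\<close> is a local homeomorphism.
\<close>

lemma image_interior: "f ` interior K \<subseteq> interior K"
proof
  fix y assume "y \<in> f ` interior K"
  then obtain x where x: "x \<in> interior K" "y = f x" by auto
  obtain r where r: "r > 0" "ball x r \<subseteq> K"
    using x by (meson mem_interior)
  have hol: "f holomorphic_on ball x r"
    using analytic_imp_holomorphic analytic_on_subset[OF analytic_K] r(2) by blast
  have nc: "\<not> f constant_on ball x r"
  proof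
    assume "f constant_on ball x r"
    then have c: "f w = f x" if "w \<in> ball x r" for w
      using that r(1) unfolding constant_on_def by (metis centre_in_ball)
    have inf: "infinite (ball x r)"
      using r(1) by (simp add: uncountable_infinite uncountable_ball)
    show False
    proof (cases "f x = a")
      case True
      then have "ball x r \<subseteq> {x \<in> K. f x = a}"
        using c r(2) by blast
      then show False
        using inf finite_fibre_a finite_subset by blast
    next
      case False
      then have fx: "f x \<in> \<Omega>"
        using x(1) interior_subset image_K K_subset by blast
      then obtain T U q where TU: "x \<in> T" "openin (top_of_set (f -` \<Omega>)) T" "homeomorphism T U f q"
        using covering_space_local_homeomorphism[OF covering, of x] by (metis vimageI2)
      then have "open T" "inj_on f T"
        using open_preimage openin_open_eq
        by (auto simp: homeomorphism_def intro: inj_on_inverseI)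
      then have "open (T \<inter> ball x r)" "x \<in> T \<inter> ball x r"
        using TU r by auto
      then obtain w where "w \<noteq> x" "w \<in> T \<inter> ball x r"
        by (metis not_open_singleton singleton_iff subsetI subset_singletonD equals0D)
      then show False
        using c \<open>inj_on f T\<close> TU(1) by (auto dest: inj_onD)
    qed
  qed
  have "open (f ` ball x r)"
    using open_mapping_thm[OF hol _ _ _ _ nc] by auto
  moreover have "f ` ball x r \<subseteq> K"
    using r image_K by blast
  ultimately show "y \<in> interior K"
    using x r by (auto intro: interiorI)
qed

lemma iterate_interior: "x \<in> interior K \<Longrightarrow> (f ^^ m) x \<in> interior K"
  using image_interior by (induction m) auto

text \<open>
  A convex set is simply connected, so it lifts through the covering \<open>m\<close> times; the lifts stay in \<open>\<Omega>\<close>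
  because \<open>f -` \<Omega> \<subseteq> \<Omega>\<close>.
\<close>

lemma inverse_branch:
  assumes D: "open D" "convex D" "D \<subseteq> \<Omega>" "y \<in> D" and z: "(f ^^ m) z = y"
  obtains \<psi> where "\<psi> holomorphic_on D" "\<psi> ` D \<subseteq> \<Omega>" "\<psi> y = z"
    "\<And>x. x \<in> D \<Longrightarrow> (f ^^ m) (\<psi> x) = x"
proof -
  have "\<exists>\<psi>. \<psi> holomorphic_on D \<and> \<psi> ` D \<subseteq> \<Omega> \<and> \<psi> y = z \<and> (\<forall>x\<in>D. (f ^^ m) (\<psi> x) = x)"
    using z
  proof (induction m arbitrary: z)
    case 0
    then show ?case
      using D by (intro exI[of _ "\<lambda>x. x"]) auto
  next
    case (Suc m)
    then have "(f ^^ m) (f z) = y"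
      by (simp add: funpow_swap1)
    from Suc.IH[OF this] obtain \<phi> where \<phi>: "\<phi> holomorphic_on D" "\<phi> ` D \<subseteq> \<Omega>" "\<phi> y = f z"
      "\<And>x. x \<in> D \<Longrightarrow> (f ^^ m) (\<phi> x) = x" by blast
    have z: "z \<in> f -` \<Omega>"
      using \<phi>(2,3) D(4) by (metis image_subset_iff vimageI)
    obtain \<psi> where \<psi>: "continuous_on D \<psi>" "\<psi> \<in> D \<rightarrow> f -` \<Omega>" "\<psi> y = z"
      "\<And>x. x \<in> D \<Longrightarrow> f (\<psi> x) = \<phi> x"
    proof (rule covering_space_lift_strong[OF covering z D(4)])
      show "simply_connected D" "locally path_connected D"
        using D by (auto simp: convex_imp_simply_connected convex_imp_locally_path_connected)
      show "continuous_on D \<phi>"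
        using \<phi> holomorphic_on_imp_continuous_on by blast
    qed (use \<phi> in auto)
    have "\<psi> holomorphic_on D"
      using covering_space_lift_is_holomorphic[OF covering open_preimage holomorphic_preimage \<phi>(1) _ \<psi>(2,1)]
        \<phi>(2) \<psi>(4) by blast
    moreover have "\<psi> ` D \<subseteq> \<Omega>"
      using \<psi>(2) preimage_subset by blast
    ultimately show ?case
      using \<phi> \<psi>
      by (intro exI[of _ \<psi>]) (auto simp: funpow_Suc_right simp del: funpow.simps)
  qed
  then show thesis
    using that by blast
qed

text \<open>
  A branch is injective and therefore open, so near \<open>y\<close> the values of \<open>\<psi>\<close> are also values of \<open>\<phi>\<close>, and
  applying the iterate shows that they are taken at the same points. The identity theorem does the rest.
\<close>

lemma inverse_branch_unique:
  assumes S: "open S" "connected S" "y \<in> S"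
    and hol: "\<phi> holomorphic_on S" "\<psi> holomorphic_on S"
    and inv: "\<And>x. x \<in> S \<Longrightarrow> (f ^^ m) (\<phi> x) = x" "\<And>x. x \<in> S \<Longrightarrow> (f ^^ m) (\<psi> x) = x"
    and "\<phi> y = \<psi> y" and "x \<in> S"
  shows "\<phi> x = \<psi> x"
proof -
  have "inj_on \<phi> S"
    using inv(1) by (rule inj_on_inverseI)
  then have "open (\<phi> ` S)"
    using open_mapping_thm3 S hol by blast
  moreover have "continuous_on S \<psi>"
    using hol holomorphic_on_imp_continuous_on by blast
  ultimately have "open (S \<inter> \<psi> -` (\<phi> ` S))"
    using S by (metis continuous_on_open_vimage inf_commute)
  moreover have "S \<inter> \<psi> -` (\<phi> ` S) \<noteq> {}"
    using S(3) assms(8)[symmetric] by auto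
  moreover have agree: "\<phi> w = \<psi> w" if "w \<in> S \<inter> \<psi> -` (\<phi> ` S)" for w
    using that inv by (metis (no_types, lifting) IntE imageE vimageE)
  ultimately show ?thesis
    by (intro analytic_continuation_open[OF _ S(1) _ S(2) Int_lower1 hol agree \<open>x \<in> S\<close>])
qed

definition branch_limit ::
  "complex set \<Rightarrow> (nat \<Rightarrow> nat) \<Rightarrow> (nat \<Rightarrow> complex \<Rightarrow> complex) \<Rightarrow> (complex \<Rightarrow> complex) \<Rightarrow> bool" where
  "branch_limit D m \<psi> g \<longleftrightarrow>
     strict_mono m \<and> (\<forall>j. \<psi> j holomorphic_on D \<and> \<psi> j ` D \<subseteq> \<Omega> \<and> (\<forall>x\<in>D. (f ^^ m j) (\<psi> j x) = x)) \<and>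
     g holomorphic_on D \<and> (\<forall>L. compact L \<longrightarrow> L \<subseteq> D \<longrightarrow> uniform_limit L \<psi> g sequentially)"

lemma branch_limitD:
  assumes "branch_limit D m \<psi> g"
  shows "strict_mono m" "\<psi> j holomorphic_on D" "x \<in> D \<Longrightarrow> (f ^^ m j) (\<psi> j x) = x"
    "g holomorphic_on D" "compact L \<Longrightarrow> L \<subseteq> D \<Longrightarrow> uniform_limit L \<psi> g sequentially"
  using assms by (auto simp: branch_limit_def)

lemma branch_limit_subset:
  "branch_limit D m \<psi> g \<Longrightarrow> D' \<subseteq> D \<Longrightarrow> branch_limit D' m \<psi> g"
  unfolding branch_limit_def by (auto intro: holomorphic_on_subset)

lemma branch_limit_subseq:
  assumes "branch_limit D m \<psi> g" "strict_mono r"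
  shows "branch_limit D (m \<circ> r) (\<psi> \<circ> r) g"
proof -
  have "uniform_limit L (\<psi> \<circ> r) g sequentially" if "uniform_limit L \<psi> g sequentially" for L :: "complex set"
    using filterlim_compose[OF that filterlim_subseq[OF assms(2)]] by (simp add: o_def)
  then show ?thesis
    using assms unfolding branch_limit_def by (auto simp: strict_mono_o)
qed

text \<open>
  The branches take values in the bounded set \<open>\<Omega>\<close>, so Montel's theorem applies.
\<close>

lemma branch_limit_exists:
  fixes m :: "nat \<Rightarrow> nat" and y z :: "nat \<Rightarrow> complex"
  assumes D: "open D" "convex D" "D \<subseteq> \<Omega>" and m: "strict_mono m"
    and yz: "\<And>j. y j \<in> D" "\<And>j. (f ^^ m j) (z j) = y j"
  obtains r \<psi> g where "strict_mono r" "branch_limit D (m \<circ> r) \<psi> g" "\<And>j. \<psi> j (y (r j)) = z (r j)"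
proof -
  have "\<exists>\<psi>. \<psi> holomorphic_on D \<and> \<psi> ` D \<subseteq> \<Omega> \<and> \<psi> (y j) = z j \<and> (\<forall>x\<in>D. (f ^^ m j) (\<psi> x) = x)" for j
    using inverse_branch[OF D yz] by metis
  then obtain \<psi> where \<psi>: "\<And>j. \<psi> j holomorphic_on D" "\<And>j. \<psi> j ` D \<subseteq> \<Omega>" "\<And>j. \<psi> j (y j) = z j"
    "\<And>j x. x \<in> D \<Longrightarrow> (f ^^ m j) (\<psi> j x) = x"
    by metis
  obtain B where B: "\<And>x. x \<in> \<Omega> \<Longrightarrow> norm x \<le> B"
    using bounded_Omega bounded_iff by blast
  have bd: "\<exists>B. \<forall>h\<in>range \<psi>. \<forall>z\<in>L. norm (h z) \<le> B" if "L \<subseteq> D" for L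
    using \<psi>(2) B that by (intro exI[of _ B]) blast
  obtain g r where g: "g holomorphic_on D" "strict_mono (r :: nat \<Rightarrow> nat)"
    "\<And>L. compact L \<Longrightarrow> L \<subseteq> D \<Longrightarrow> uniform_limit L (\<psi> \<circ> r) g sequentially"
    using Montel[OF D(1), of "range \<psi>" \<psi>] \<psi>(1) bd by (metis (no_types, lifting) imageE order_refl)
  show thesis
  proof
    show "branch_limit D (m \<circ> r) (\<psi> \<circ> r) g"
      using \<psi> g m unfolding branch_limit_def by (auto simp: strict_mono_o)
  qed (use \<psi> g in auto)
qed

lemma nonconstant_subset:
  assumes "g holomorphic_on D" "open D" "connected D" "\<not> g constant_on D"
    and "D' \<subseteq> D" "open D'" "D' \<noteq> {}"
  shows "\<not> g constant_on D'"
proof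
  assume "g constant_on D'"
  then obtain c where c: "\<And>x. x \<in> D' \<Longrightarrow> g x = c"
    unfolding constant_on_def by blast
  have "g x = c" if "x \<in> D" for x
    using analytic_continuation_open[of D' D g "\<lambda>_. c"] assms c that by auto
  then show False
    using assms(4) unfolding constant_on_def by blast
qed

text \<open>
  If \<open>y\<close> were outside \<open>K\<close>, Hurwitz's theorem would show that the value \<open>b = g y\<close> is attained near \<open>y\<close> by
  infinitely many of the branches. The orbit of \<open>b\<close> would then return infinitely often to a compact
  neighbourhood of \<open>y\<close>, although points outside \<open>K\<close> escape from it.
\<close>

lemma branch_limit_outside_K:
  assumes "branch_limit (ball y e) m \<psi> g" "e > 0" "ball y e \<subseteq> \<Omega>" "\<not> g constant_on ball y e"
  shows "y \<in> K"
proof (rule ccontr)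
  assume "y \<notin> K"
  have "open (ball y e - K)" "y \<in> ball y e - K"
    using compact_K assms(2) \<open>y \<notin> K\<close> by (auto simp: compact_imp_closed open_Diff)
  then obtain d where d: "d > 0" "cball y d \<subseteq> ball y e - K"
    by (meson open_contains_cball)
  have sub: "ball y d \<subseteq> ball y e" using d ball_subset_cball by blast
  have bl: "branch_limit (ball y d) m \<psi> g"
    using assms(1) sub by (rule branch_limit_subset)
  have hol: "g holomorphic_on ball y d" "g holomorphic_on ball y e"
    using bl assms(1) by (auto simp: branch_limit_def)
  have nc: "\<not> g constant_on ball y d"
    by (rule nonconstant_subset[OF hol(2)]) (use assms sub d in auto)
  define b where "b = g y"
  have hit: "\<exists>j\<ge>N. \<exists>x\<in>ball y d. \<psi> j x = b" for N
  proof (rule ccontr)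
    assume no: "\<not> ?thesis"
    have "g y - b \<noteq> 0"
    proof (rule Hurwitz_no_zeros[of "ball y d" "\<lambda>j x. \<psi> (j + N) x - b" "\<lambda>x. g x - b" y])
      show "(\<lambda>x. \<psi> (n + N) x - b) holomorphic_on ball y d" for n
        using bl by (intro holomorphic_intros) (auto simp: branch_limit_def)
      show "(\<lambda>x. g x - b) holomorphic_on ball y d"
        using hol by (intro holomorphic_intros)
      show "uniform_limit L (\<lambda>n x. \<psi> (n + N) x - b) (\<lambda>x. g x - b) sequentially"
        if "compact L" "L \<subseteq> ball y d" for L
      proof -
        have "uniform_limit L \<psi> g sequentially"
          using bl that by (auto simp: branch_limit_def)
        then have "uniform_limit L (\<lambda>n. \<psi> (n + N)) g sequentially"
          by (rule filterlim_compose) (auto simp: filterlim_subseq strict_mono_def)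
        then show ?thesis
          by (intro uniform_limit_intros) auto
      qed
      show "\<not> (\<lambda>x. g x - b) constant_on ball y d"
        using nc unfolding constant_on_def by (metis diff_add_cancel)
    qed (use no d in auto)
    then show False by (simp add: b_def)
  qed
  have sm: "strict_mono m" and inv: "\<And>j x. x \<in> ball y d \<Longrightarrow> (f ^^ m j) (\<psi> j x) = x"
    using bl by (auto simp: branch_limit_def)
  have ret: "\<exists>k\<ge>N. (f ^^ k) b \<in> cball y d" for N
  proof -
    obtain j x where "j \<ge> N" "x \<in> ball y d" "\<psi> j x = b"
      using hit by blast
    then show ?thesis
      using inv[of x j] seq_suble[OF sm, of j] by (intro exI[of _ "m j"]) auto
  qed
  have dO: "cball y d \<subseteq> \<Omega>"
    using d assms(3) by blast
  obtain k where k: "(f ^^ k) b \<in> cball y d"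
    using ret by blast
  have "b \<in> \<Omega>"
    using k dO iterate_preimage by blast
  moreover have "b \<notin> K"
    using k d iterate_in_K by blast
  ultimately have "eventually (\<lambda>m. (f ^^ m) b \<notin> cball y d) sequentially"
    by (intro escape compact_cball dO)
  then show False
    using ret by (auto simp: eventually_sequentially)
qed

text \<open>
  The points at which expansion fails: pulling back a small disc by suitable iterates does not shrink it
  to a point.
\<close>

definition unexpanded :: "complex set" where
  "unexpanded = {y. \<exists>e>0. ball y e \<subseteq> \<Omega> \<and> (\<exists>m \<psi> g. branch_limit (ball y e) m \<psi> g \<and> \<not> g constant_on ball y e)}"

lemma unexpanded_subset: "unexpanded \<subseteq> K" "unexpanded \<subseteq> \<Omega>"
  using branch_limit_outside_K by (auto simp: unexpanded_def)

lemma open_unexpanded: "open unexpanded"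
  unfolding open_contains_ball
proof
  fix y assume "y \<in> unexpanded"
  then obtain e m \<psi> g where e: "e > 0" "ball y e \<subseteq> \<Omega>" "branch_limit (ball y e) m \<psi> g"
    "\<not> g constant_on ball y e"
    by (auto simp: unexpanded_def)
  have "x \<in> unexpanded" if "x \<in> ball y (e/2)" for x
  proof -
    have sub: "ball x (e/2) \<subseteq> ball y e"
      using that by (simp add: subset_iff) (smt (verit) dist_triangle dist_commute)
    have "\<not> g constant_on ball x (e/2)"
      using e by (intro nonconstant_subset[OF _ _ _ e(4) sub]) (auto simp: branch_limit_def)
    then show ?thesis
      using e sub branch_limit_subset[OF e(3) sub]
      unfolding unexpanded_def by (intro CollectI exI[of _ "e/2"]) auto
  qed
  then show "\<exists>e>0. ball y e \<subseteq> unexpanded"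
    using e(1) by (intro exI[of _ "e/2"]) auto
qed

text \<open>
  Continuing the branches from a neighbourhood of \<open>y\<close> to the whole ball around \<open>x\<close> keeps their limit
  nonconstant. The ball does not depend on \<open>y\<close>, so the set is relatively closed in \<open>\<Omega>\<close>.
\<close>

lemma unexpanded_near:
  assumes D: "ball x d \<subseteq> \<Omega>" "d > 0" and y: "y \<in> unexpanded" "y \<in> ball x d"
  shows "x \<in> unexpanded"
proof -
  obtain e m \<psi> g where e: "e > 0" "ball y e \<subseteq> \<Omega>" "branch_limit (ball y e) m \<psi> g"
    "\<not> g constant_on ball y e"
    using y by (auto simp: unexpanded_def)
  have m: "strict_mono m" "\<And>j. (f ^^ m j) (\<psi> j y) = y" "g holomorphic_on ball y e"
    using e(1,3) by (auto simp: branch_limit_def)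
  obtain r \<phi> h where r: "strict_mono r" "branch_limit (ball x d) (m \<circ> r) \<phi> h"
    "\<And>j. \<phi> j y = \<psi> (r j) y"
    using branch_limit_exists[OF open_ball convex_ball D(1) m(1), of "\<lambda>_. y" "\<lambda>j. \<psi> j y"] m(2) y(2)
    by auto
  define S where "S = ball x d \<inter> ball y e"
  have S: "open S" "connected S" "y \<in> S" "S \<subseteq> ball y e" "S \<subseteq> ball x d"
    using y(2) e(1) by (auto simp: S_def convex_Int convex_connected)
  have bl: "branch_limit S (m \<circ> r) \<phi> h" "branch_limit S (m \<circ> r) (\<psi> \<circ> r) g"
    using branch_limit_subset[OF r(2) S(5)]
      branch_limit_subset[OF branch_limit_subseq[OF e(3) r(1)] S(4)] .
  have same: "\<phi> j w = \<psi> (r j) w" if "w \<in> S" for j w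
    by (rule inverse_branch_unique[OF S(1-3), of _ _ "m (r j)"])
       (use bl that r(3) in \<open>auto simp: branch_limit_def\<close>)
  have "h w = g w" if w: "w \<in> S" for w
  proof -
    have u: "uniform_limit L \<phi> h sequentially" "uniform_limit L (\<psi> \<circ> r) g sequentially"
      if "compact L" "L \<subseteq> S" for L
      using bl that unfolding branch_limit_def by auto
    have "(\<lambda>j. \<phi> j w) \<longlonglongrightarrow> h w"
      using tendsto_uniform_limitI[OF u(1)[of "{w}"], of w] w by simp
    moreover have "(\<lambda>j. \<phi> j w) \<longlonglongrightarrow> g w"
      using tendsto_uniform_limitI[OF u(2)[of "{w}"], of w] w same[OF w] by simp
    ultimately
    show ?thesis
      using LIMSEQ_unique by blast
  qed
  moreover have "\<not> g constant_on S"
    by (rule nonconstant_subset[OF m(3) _ _ e(4) S(4)]) (use S in auto)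
  ultimately have "\<not> h constant_on S"
    by (simp add: constant_on_def)
  then have "\<not> h constant_on ball x d"
    using S(5) constant_on_subset by blast
  then show ?thesis
    using r(2) D unfolding unexpanded_def by blast
qed

text \<open>
  The plane punctured at \<open>a\<close> is connected, and in it the unexpanded points form an open and closed
  subset: limit points in \<open>\<Omega>\<close> are covered by continuation of branches, and limit points outside \<open>\<Omega>\<close>
  lie in \<open>K\<close>, so only \<open>a\<close> is possible. Being bounded, the set is not the whole punctured plane.
\<close>

lemma unexpanded_empty: "unexpanded = {}"
proof (rule ccontr)
  assume ne: "unexpanded \<noteq> {}"
  have "open (- {a} - unexpanded)"
    unfolding open_contains_ball
  proof
    fix x assume x: "x \<in> - {a} - unexpanded"
    show "\<exists>e>0. ball x e \<subseteq> - {a} - unexpanded"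
    proof (cases "x \<in> \<Omega>")
      case True
      then obtain d where d: "d > 0" "ball x d \<subseteq> \<Omega>"
        using open_Omega open_contains_ball by blast
      then have "ball x d \<inter> unexpanded = {}"
        using unexpanded_near x by blast
      then show ?thesis
        using d a_notin_Omega by (intro exI[of _ d]) auto
    next
      case False
      then have "x \<in> - K"
        using K_subset x by auto
      then obtain d where "d > 0" "ball x d \<subseteq> - K"
        using compact_K by (meson compact_imp_closed open_Compl open_contains_ball)
      then show ?thesis
        using unexpanded_subset a_in_K by (intro exI[of _ d]) auto
    qed
  qed
  moreover have "connected (- {a})"
    using connected_punctured_universe[of a] by simp
  moreover have "unexpanded \<subseteq> - {a}"
    using unexpanded_subset a_notin_Omega by auto
  ultimately have "- {a} \<subseteq> unexpanded"
    using connectedD[of "- {a}" unexpanded "- {a} - unexpanded"] ne open_unexpanded by blast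
  then have "(UNIV :: complex set) \<subseteq> insert a \<Omega>"
    using unexpanded_subset by blast
  then have "bounded (UNIV :: complex set)"
    using bounded_Omega bounded_insert bounded_subset by blast
  then show False
    by simp
qed

text \<open>
  While an orbit is close to \<open>a\<close>, its distance to \<open>a\<close> grows geometrically.
\<close>

lemma escapes_repelling_fixed_point:
  obtains \<epsilon> where "\<epsilon> > 0" "\<And>x. x \<noteq> a \<Longrightarrow> \<exists>m. dist ((f ^^ m) x) a \<ge> \<epsilon>"
proof -
  define \<mu> where "\<mu> = (1 + norm (deriv f a)) / 2"
  have \<mu>: "\<mu> > 1" "norm (deriv f a) > \<mu>"
    using repelling_a by (auto simp: \<mu>_def)
  have "((\<lambda>x. (f x - f a) / (x - a)) \<longlongrightarrow> deriv f a) (at a)"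
    using f_differentiable_a by (simp add: has_field_derivative_iff)
  then have "((\<lambda>x. norm ((f x - f a) / (x - a))) \<longlongrightarrow> norm (deriv f a)) (at a)"
    by (rule tendsto_norm)
  then have "eventually (\<lambda>x. norm ((f x - f a) / (x - a)) > \<mu>) (at a)"
    using \<mu>(2) order_tendstoD(1) by blast
  then obtain \<epsilon> where \<epsilon>: "\<epsilon> > 0" "\<And>x. x \<noteq> a \<Longrightarrow> dist x a < \<epsilon> \<Longrightarrow> norm ((f x - f a) / (x - a)) > \<mu>"
    by (auto simp: eventually_at)
  have grow: "dist (f x) a \<ge> \<mu> * dist x a" if "dist x a < \<epsilon>" for x
  proof (cases "x = a")
    case False
    then show ?thesis
      using \<epsilon>(2)[OF False that] by (simp add: fixed_a dist_norm norm_divide field_simps)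
  qed (simp add: fixed_a)
  show thesis
  proof
    fix x assume "x \<noteq> a"
    show "\<exists>m. dist ((f ^^ m) x) a \<ge> \<epsilon>"
    proof (rule ccontr)
      assume "\<not> ?thesis"
      then have near: "dist ((f ^^ m) x) a < \<epsilon>" for m
        by (simp add: not_le)
      have "dist ((f ^^ m) x) a \<ge> \<mu> ^ m * dist x a" for m
      proof (induction m)
        case (Suc m)
        have "\<mu> * (\<mu> ^ m * dist x a) \<le> \<mu> * dist ((f ^^ m) x) a"
          using Suc \<mu>(1) by (intro mult_left_mono) auto
        then show ?case
          using grow[OF near[of m]] by (simp add: mult.assoc)
      qed auto
      then have "\<mu> ^ m < \<epsilon> / dist x a" for m
        using near[of m] \<open>x \<noteq> a\<close> by (smt (verit) pos_less_divide_eq zero_less_dist_iff)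
      then show False
        using \<mu>(1) by (meson less_asym real_arch_pow)
    qed
  qed (use \<epsilon> in auto)
qed

lemma norm_deriv_le_of_near_constant:
  assumes "\<psi> holomorphic_on ball y r" "r > 0" "\<And>w. w \<in> ball y r \<Longrightarrow> dist (\<psi> w) c < \<eta>"
  shows "norm (deriv \<psi> y) \<le> 2 * \<eta> / r"
proof -
  have "norm ((deriv ^^ 1) \<psi> y) \<le> fact 1 * \<eta> / (r / 2) ^ 1"
  proof (rule Cauchy_higher_deriv_bound)
    have hol: "\<psi> holomorphic_on cball y (r/2)"
      using assms by (intro holomorphic_on_subset[OF assms(1)]) auto
    show "\<psi> holomorphic_on ball y (r/2)" "continuous_on (cball y (r/2)) \<psi>"
      using hol holomorphic_on_subset[OF hol] holomorphic_on_imp_continuous_on by auto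
    show "\<psi> w \<in> ball c \<eta>" if "w \<in> ball y (r/2)" for w
      using assms(3)[of w] that assms(2) by (auto simp: dist_commute)
  qed (use assms in auto)
  then show ?thesis
    by (simp add: field_simps)
qed

text \<open>
  The orbit of an interior point \<open>z\<close> never meets \<open>a\<close>, so it is infinitely often away from \<open>a\<close> and
  accumulates at some \<open>y\<close> in \<open>\<Omega>\<close>. Consider inverse branches near \<open>y\<close> that lead back to \<open>z\<close>. As the
  derivatives of the iterates at \<open>z\<close> are bounded, the derivatives of these branches are bounded below,
  their limit is not constant, and \<open>y\<close> is unexpanded.
\<close>

theorem interior_K_empty: "interior K = {}"
proof (rule ccontr)
  assume "interior K \<noteq> {}"
  then obtain z where z: "z \<in> interior K" by blast
  obtain C where C: "C > 0" "\<And>m. norm (deriv (f ^^ m) z) \<le> C"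
    using iterate_deriv_bounded[OF z] by metis
  obtain \<epsilon> where \<epsilon>: "\<epsilon> > 0" "\<And>x. x \<noteq> a \<Longrightarrow> \<exists>m. dist ((f ^^ m) x) a \<ge> \<epsilon>"
    using escapes_repelling_fixed_point by metis
  define M where "M = {m. dist ((f ^^ m) z) a \<ge> \<epsilon>}"
  have "\<exists>m\<ge>N. m \<in> M" for N
  proof -
    have "(f ^^ N) z \<noteq> a"
      using iterate_interior[OF z] a_notin_interior by metis
    then obtain k where "dist ((f ^^ k) ((f ^^ N) z)) a \<ge> \<epsilon>"
      using \<epsilon> by blast
    then show ?thesis
      by (intro exI[of _ "k + N"]) (auto simp: M_def funpow_add)
  qed
  then have "infinite M"
    using infinite_nat_iff_unbounded_le by blast
  then obtain s :: "nat \<Rightarrow> nat" where s: "strict_mono s" "\<And>j. s j \<in> M"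
    using infinite_enumerate by blast
  have cpt: "compact (K - ball a \<epsilon>)"
    using compact_K by (simp add: compact_diff)
  have orbit: "(f ^^ s j) z \<in> K - ball a \<epsilon>" for j
    using s(2)[of j] iterate_in_K[OF interior_subset[THEN subsetD, OF z], of "s j"]
    by (simp add: M_def dist_commute)
  obtain y t where y: "y \<in> K - ball a \<epsilon>" and t: "strict_mono (t :: nat \<Rightarrow> nat)"
      "((\<lambda>j. (f ^^ s j) z) \<circ> t) \<longlonglongrightarrow> y"
    using seq_compactE[OF compact_imp_seq_compact[OF cpt], of "\<lambda>j. (f ^^ s j) z"] orbit by blast
  have "y \<in> \<Omega>"
    using y K_subset \<epsilon>(1) by auto
  then obtain e where e: "e > 0" "ball y e \<subseteq> \<Omega>"
    using open_Omega open_contains_ball by blast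
  define d where "d = e / 3"
  have d: "d > 0" "ball y (3 * d) \<subseteq> \<Omega>"
    using e by (auto simp: d_def)
  have "eventually (\<lambda>j. dist ((f ^^ s (t j)) z) y < d) sequentially"
    using tendstoD[OF t(2) d(1)] by (simp add: o_def)
  then obtain N where N: "\<And>j. j \<ge> N \<Longrightarrow> dist ((f ^^ s (t j)) z) y < d"
    by (auto simp: eventually_sequentially)
  define m where "m j = s (t (j + N))" for j
  have m: "strict_mono m" "\<And>j. dist ((f ^^ m j) z) y < d"
    using s(1) t(1) N by (auto simp: m_def strict_mono_def)
  obtain r \<psi> g where r: "strict_mono r" "branch_limit (ball y (3 * d)) (m \<circ> r) \<psi> g"
    "\<And>j. \<psi> j ((f ^^ m (r j)) z) = z"
  proof (rule branch_limit_exists[OF open_ball convex_ball d(2) m(1), of "\<lambda>j. (f ^^ m j) z" "\<lambda>_. z"])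
    show "(f ^^ m j) z \<in> ball y (3 * d)" for j
      using m(2)[of j] d(1) by (simp add: dist_commute)
  qed auto
  have "\<not> g constant_on ball y (3 * d)"
  proof
    assume "g constant_on ball y (3 * d)"
    then obtain c where c: "\<And>x. x \<in> ball y (3 * d) \<Longrightarrow> g x = c"
      unfolding constant_on_def by blast
    \<comment> \<open>Being \<open>\<eta>\<close>-close to a constant on a disc of radius \<open>d\<close> bounds the derivative of a branch
       by \<open>2 * \<eta> / d\<close>, which is half of the lower bound \<open>1 / C\<close>.\<close>
    define \<eta> where "\<eta> = d / (4 * C)"
    have \<eta>: "\<eta> > 0"
      using d(1) C(1) by (simp add: \<eta>_def)
    have "cball y (2 * d) \<subseteq> ball y (3 * d)"
      using d(1) by auto
    then have "uniform_limit (cball y (2 * d)) \<psi> g sequentially"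
      by (rule branch_limitD(5)[OF r(2) compact_cball])
    from uniform_limitD[OF this \<eta>] obtain j where
      "\<forall>n\<ge>j. \<forall>x\<in>cball y (2 * d). dist (\<psi> n x) (g x) < \<eta>"
      unfolding eventually_sequentially by blast
    then have j: "\<And>x. x \<in> cball y (2 * d) \<Longrightarrow> dist (\<psi> j x) (g x) < \<eta>"
      by blast
    define w where "w = (f ^^ m (r j)) z"
    have w: "dist w y < d"
      using m(2) by (simp add: w_def)
    have "dist y x < 2 * d" if "x \<in> ball w d" for x
      using that w dist_triangle[of y x w] by (simp add: dist_commute)
    then have sub: "ball w d \<subseteq> cball y (2 * d)" "ball w d \<subseteq> ball y (3 * d)"
      using d(1) by (force simp: subset_iff)+
    have hol: "\<psi> j holomorphic_on ball w d"
      by (rule holomorphic_on_subset[OF branch_limitD(2)[OF r(2)] sub(2)])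
    have "norm (deriv (\<psi> j) w) \<le> 2 * \<eta> / d"
      using j c sub by (intro norm_deriv_le_of_near_constant[OF hol d(1), of c]) (metis subsetD)
    also have "\<dots> = 1 / (2 * C)"
      using d(1) by (simp add: \<eta>_def)
    finally have small: "norm (deriv (\<psi> j) w) \<le> 1 / (2 * C)" .
    have "((f ^^ m (r j)) has_field_derivative deriv (f ^^ m (r j)) z) (at z)"
      using iterate_analytic_K z interior_subset
      by (meson analytic_on_imp_differentiable_at DERIV_deriv_iff_field_differentiable subsetD)
    then have D1: "((f ^^ m (r j)) has_field_derivative deriv (f ^^ m (r j)) z) (at (\<psi> j w))"
      using r(3) by (simp add: w_def)
    have D2: "(\<psi> j has_field_derivative deriv (\<psi> j) w) (at w)"
      using hol d(1) holomorphic_derivI[of "\<psi> j" "ball w d" w] by auto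
    have "((f ^^ m (r j)) \<circ> \<psi> j has_field_derivative deriv (f ^^ m (r j)) z * deriv (\<psi> j) w) (at w)"
      using DERIV_chain[OF D1 D2] .
    moreover have "((f ^^ m (r j)) \<circ> \<psi> j has_field_derivative 1) (at w)"
    proof (rule has_field_derivative_transform_within[OF DERIV_ident d(1)])
      show "x = ((f ^^ m (r j)) \<circ> \<psi> j) x" if "dist x w < d" for x
        using branch_limitD(3)[OF r(2), of x j] sub(2) that by (auto simp: dist_commute subset_iff)
    qed auto
    ultimately have "deriv (f ^^ m (r j)) z * deriv (\<psi> j) w = 1"
      using DERIV_unique by blast
    then have "1 = norm (deriv (f ^^ m (r j)) z) * norm (deriv (\<psi> j) w)"
      by (metis norm_mult norm_one)
    also have "\<dots> \<le> C * (1 / (2 * C))"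
      using C small by (intro mult_mono) auto
    also have "\<dots> < 1"
      using C(1) by simp
    finally show False by simp
  qed
  then have "y \<in> unexpanded"
    using r(2) d unfolding unexpanded_def by (intro CollectI exI[of _ "3 * d"]) auto
  then show False
    using unexpanded_empty by blast
qed

end

section \<open>Rational functions as covering maps\<close>

text \<open>
  Around the \<open>d\<close> points of a fibre choose disjoint discs on which \<open>f\<close> is injective. Over a small
  neighbourhood each disc contributes one preimage; as every fibre has exactly \<open>d\<close> points, there are no
  others, which takes the place of a properness argument.
\<close>

lemma covering_space_of_constant_fibre_card:
  fixes f :: "complex \<Rightarrow> complex"
  assumes X: "open X" "f holomorphic_on X" "f ` X \<subseteq> S" and S: "open S"
    and regular: "\<And>x. x \<in> X \<Longrightarrow> deriv f x \<noteq> 0"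
    and fibre: "\<And>y. y \<in> S \<Longrightarrow> card {x \<in> X. f x = y} = d" and d: "d > 0"
  shows "covering_space X f S"
proof
  show "continuous_on X f"
    using X holomorphic_on_imp_continuous_on by blast
  have fin: "finite {x \<in> X. f x = y}" if "y \<in> S" for y
    using fibre[OF that] d card_gt_0_iff by metis
  have "\<exists>x\<in>X. f x = y" if "y \<in> S" for y
    using fibre[OF that] d by (metis (mono_tags, lifting) Collect_empty_eq card.empty less_irrefl)
  then show "f ` X = S"
    using X(3) by blast
  fix y assume y: "y \<in> S"
  define F where "F = {x \<in> X. f x = y}"
  have finF: "finite F" "card F = d"
    using fin fibre y by (auto simp: F_def)
  have "\<exists>r>0. ball x r \<subseteq> X \<and> inj_on f (ball x r) \<and> (\<forall>x'\<in>F. x' \<noteq> x \<longrightarrow> 2 * r \<le> dist x x')"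
    if "x \<in> F" for x
  proof -
    obtain r1 where r1: "r1 > 0" "ball x r1 \<subseteq> X" "inj_on f (ball x r1)"
      using has_complex_derivative_locally_injective[OF X(2) _ X(1) regular] \<open>x \<in> F\<close>
      by (metis (no_types, lifting) F_def mem_Collect_eq)
    obtain r2 where r2: "r2 > 0" "\<forall>x'\<in>F. x' \<noteq> x \<longrightarrow> r2 \<le> dist x x'"
      using finite_set_avoid[OF finF(1)] by blast
    have sub: "ball x (min r1 (r2 / 2)) \<subseteq> ball x r1"
      by auto
    show ?thesis
      using r1 r2 sub inj_on_subset[OF r1(3) sub]
      by (intro exI[of _ "min r1 (r2 / 2)"]) (auto simp: min_def)
  qed
  then obtain r where r: "\<And>x. x \<in> F \<Longrightarrow> r x > 0" "\<And>x. x \<in> F \<Longrightarrow> ball x (r x) \<subseteq> X"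
    "\<And>x. x \<in> F \<Longrightarrow> inj_on f (ball x (r x))"
    "\<And>x x'. x \<in> F \<Longrightarrow> x' \<in> F \<Longrightarrow> x' \<noteq> x \<Longrightarrow> 2 * r x \<le> dist x x'"
    by metis
  define V where "V x = ball x (r x)" for x
  have disjV: "V x \<inter> V x' = {}" if "x \<in> F" "x' \<in> F" "x \<noteq> x'" for x x'
  proof -
    have "r x + r x' \<le> dist x x'"
      using r(4)[of x x'] r(4)[of x' x] that by (auto simp: dist_commute)
    then show ?thesis
      unfolding V_def by (rule disjoint_ballI)
  qed
  define T where "T = S \<inter> (\<Inter>x\<in>F. f ` V x)"
  have "open (f ` V x)" if "x \<in> F" for x
    using open_mapping_thm3[of f "V x"] r that X(2) holomorphic_on_subset unfolding V_def by blast
  then have "open T"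
    unfolding T_def using S finF(1) by (intro open_Int open_INT) auto
  have yT: "y \<in> T"
    using y r(1) unfolding T_def V_def F_def by force
  define U where "U x = V x \<inter> f -` T" for x
  have openU: "open (U x)" if "x \<in> F" for x
  proof -
    have "continuous_on (V x) f"
      using that r X(2) holomorphic_on_subset holomorphic_on_imp_continuous_on unfolding V_def by blast
    then show ?thesis
      unfolding U_def using \<open>open T\<close> by (metis V_def continuous_on_open_vimage inf_commute open_ball)
  qed
  have homeo: "\<exists>q. homeomorphism (U x) T f q" if x: "x \<in> F" for x
  proof -
    have hol: "f holomorphic_on V x"
      using x r X(2) holomorphic_on_subset unfolding V_def by blast
    obtain q where q: "q holomorphic_on f ` V x" "\<And>z. z \<in> V x \<Longrightarrow> q (f z) = z"
      using holomorphic_has_inverse[OF hol] r(3)[OF x] unfolding V_def by (metis open_ball)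
    have TV: "T \<subseteq> f ` V x"
      using x by (auto simp: T_def)
    have "homeomorphism (U x) T f q"
    proof (rule homeomorphismI)
      show "continuous_on (U x) f" "continuous_on T q"
        using hol q(1) holomorphic_on_imp_continuous_on holomorphic_on_subset TV
        unfolding U_def by (metis Int_lower1 continuous_on_subset)+
      show "f ` U x \<subseteq> T" "q ` T \<subseteq> U x" "\<And>w. w \<in> U x \<Longrightarrow> q (f w) = w" "\<And>w. w \<in> T \<Longrightarrow> f (q w) = w"
        using q(2) TV by (auto simp: U_def)
    qed
    then show ?thesis by blast
  qed
  have union: "\<Union> (U ` F) = X \<inter> f -` T"
  proof
    show "\<Union> (U ` F) \<subseteq> X \<inter> f -` T"
      using r(2) by (auto simp: U_def V_def)
    show "X \<inter> f -` T \<subseteq> \<Union> (U ` F)"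
    proof
      fix w assume w: "w \<in> X \<inter> f -` T"
      have "\<exists>z\<in>U x. f z = f w" if "x \<in> F" for x
      proof -
        have "f w \<in> f ` V x"
          using w that by (auto simp: T_def)
        then obtain z where "z \<in> V x" "f z = f w"
          by (metis imageE)
        then show ?thesis
          using w by (auto simp: U_def)
      qed
      then obtain s where s: "\<And>x. x \<in> F \<Longrightarrow> s x \<in> U x" "\<And>x. x \<in> F \<Longrightarrow> f (s x) = f w"
        by metis
      have inj: "inj_on s F"
        using s(1) disjV unfolding inj_on_def U_def by (metis IntD1 IntI empty_iff)
      have sub: "s ` F \<subseteq> {x \<in> X. f x = f w}"
        using s r(2) unfolding U_def V_def by blast
      have fw: "f w \<in> S"
        using w by (auto simp: T_def)
      have "s ` F = {x \<in> X. f x = f w}"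
        using card_subset_eq[OF fin[OF fw] sub] fibre[OF fw] finF(2) card_image[OF inj] by simp
      moreover have "w \<in> {x \<in> X. f x = f w}"
        using w by simp
      ultimately obtain x where "x \<in> F" "w = s x"
        by (metis imageE)
      then show "w \<in> \<Union> (U ` F)"
        using s(1) by blast
    qed
  qed
  have "pairwise disjnt (U ` F)"
    using disjV unfolding pairwise_def disjnt_def U_def by blast
  then show "\<exists>T. y \<in> T \<and> openin (top_of_set S) T \<and>
      (\<exists>v. \<Union>v = X \<inter> f -` T \<and> (\<forall>u\<in>v. openin (top_of_set X) u) \<and> pairwise disjnt v \<and>
        (\<forall>u\<in>v. \<exists>q. homeomorphism u T f q))"
  proof (intro exI[of _ T] exI[of _ "U ` F"] conjI ballI)
    show "openin (top_of_set S) T"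
      using \<open>open T\<close> by (simp add: openin_open_eq S T_def)
    show "openin (top_of_set X) u" if "u \<in> U ` F" for u
      using that openU union by (auto simp: openin_open_eq X(1))
    show "\<exists>q. homeomorphism u T f q" if "u \<in> U ` F" for u
      using that homeo by blast
  qed (simp_all only: yT union)
qed

lemma card_roots_simple:
  fixes p :: "complex poly"
  assumes "\<And>x. poly p x = 0 \<Longrightarrow> poly (pderiv p) x \<noteq> 0" "p \<noteq> 0"
  shows "card {x. poly p x = 0} = degree p"
proof -
  have rs: "rsquarefree p"
    using assms by (auto simp: rsquarefree_roots)
  have "degree p = degree (smult (lead_coeff p) (\<Prod>z | poly p z = 0. [:-z, 1:]))"
    using complex_poly_decompose_rsquarefree[OF rs] by simp
  also have "\<dots> = (\<Sum>z | poly p z = 0. 1)"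
    using assms(2) by (simp add: degree_prod_eq_sum_degree)
  finally show ?thesis by simp
qed

text \<open>
  The fibre over \<open>y\<close> is the set of roots of \<open>P - smult y Q\<close>. Since \<open>degree Q < degree P\<close>, the degree of
  this polynomial does not depend on \<open>y\<close>, and away from critical values its roots are simple.
\<close>

lemma covering_space_rational:
  fixes P Q :: "complex poly"
  assumes S: "open S" and deg: "degree Q < degree P"
    and coprime: "\<And>x. poly Q x = 0 \<Longrightarrow> poly P x \<noteq> 0"
    and f: "\<And>x. poly Q x \<noteq> 0 \<Longrightarrow> f x = poly P x / poly Q x"
    and poles: "\<And>x. poly Q x = 0 \<Longrightarrow> f x \<notin> S"
    and regular: "\<And>x. f x \<in> S \<Longrightarrow> poly (pderiv P * Q - P * pderiv Q) x \<noteq> 0"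
  shows "open (f -` S)" "f holomorphic_on f -` S" "covering_space (f -` S) f S"
proof -
  have X: "f -` S = {x. poly Q x \<noteq> 0} \<inter> (\<lambda>x. poly P x / poly Q x) -` S"
  proof (rule set_eqI)
    fix x
    show "x \<in> f -` S \<longleftrightarrow> x \<in> {x. poly Q x \<noteq> 0} \<inter> (\<lambda>x. poly P x / poly Q x) -` S"
      using f[of x] poles[of x] by (cases "poly Q x = 0") auto
  qed
  have "open ({x. poly Q x \<noteq> 0} \<inter> (\<lambda>x. poly P x / poly Q x) -` S)"
    by (intro continuous_open_preimage S continuous_intros open_Collect_neq) auto
  then show opn: "open (f -` S)"
    using X by simp
  have deriv: "(f has_field_derivative poly (pderiv P * Q - P * pderiv Q) x / (poly Q x)^2) (at x)"
    if "x \<in> f -` S" for x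
  proof (rule has_field_derivative_transform_within_open[OF _ opn that])
    show "((\<lambda>x. poly P x / poly Q x) has_field_derivative
            poly (pderiv P * Q - P * pderiv Q) x / (poly Q x)^2) (at x)"
      using that X by (auto intro!: derivative_eq_intros simp: power2_eq_square)
  qed (use X f in auto)
  show hol: "f holomorphic_on f -` S"
    using deriv opn holomorphic_on_open by blast
  show "covering_space (f -` S) f S"
  proof (rule covering_space_of_constant_fibre_card[OF opn hol _ S])
    show "deriv f x \<noteq> 0" if "x \<in> f -` S" for x
      using deriv[OF that] regular[of x] that X DERIV_imp_deriv by fastforce
    show "card {x \<in> f -` S. f x = y} = degree P" if y: "y \<in> S" for y
    proof -
      let ?p = "P - smult y Q"
      have degp: "degree ?p = degree P"
        using deg by (metis degree_add_eq_left degree_minus degree_smult_le diff_conv_add_uminus le_less_trans)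
      have eq: "{x \<in> f -` S. f x = y} = {x. poly ?p x = 0}"
      proof (rule set_eqI)
        fix x
        show "x \<in> {x \<in> f -` S. f x = y} \<longleftrightarrow> x \<in> {x. poly ?p x = 0}"
          using f[of x] poles[of x] coprime[of x] y
          by (cases "poly Q x = 0") (auto simp: field_simps)
      qed
      have "poly (pderiv ?p) x \<noteq> 0" if "poly ?p x = 0" for x
      proof -
        have "f x = y" using that eq by auto
        then have x: "f x \<in> S" "poly Q x \<noteq> 0" "poly P x = y * poly Q x"
          using y poles that by auto
        then show ?thesis
          using regular[OF x(1)] by (auto simp: pderiv_diff pderiv_smult algebra_simps)
      qed
      moreover have "?p \<noteq> 0"
        using degp deg by auto
      ultimately show ?thesis
        using card_roots_simple[of ?p] degp eq by simp
    qed
  qed (use deg in auto)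
qed

section \<open>Dense basins and the Fatou set\<close>

text \<open>
  Uniform convergence near the point is the form of attraction that makes the basin open and the iterates
  equicontinuous on it.
\<close>

definition attracting :: "('a::metric_space \<Rightarrow> 'a) \<Rightarrow> 'a \<Rightarrow> bool" where
  "attracting R r \<longleftrightarrow> (\<exists>N. open N \<and> r \<in> N \<and> uniform_limit N (\<lambda>m. R ^^ m) (\<lambda>_. r) sequentially)"

lemma continuous_on_funpow:
  fixes R :: "'a::topological_space \<Rightarrow> 'a"
  assumes "continuous_on UNIV R"
  shows "continuous_on UNIV (R ^^ m)"
proof (induction m)
  case (Suc m)
  then show ?case
    using continuous_on_compose2[OF assms Suc] by simp
qed (simp add: id_def)

lemma basin_iterate_iff: "(R ^^ k) x \<in> basin R r \<longleftrightarrow> x \<in> basin R r"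
proof -
  have shift: "(\<lambda>m. (R ^^ m) ((R ^^ k) x)) = (\<lambda>m. (R ^^ (m + k)) x)"
    by (simp add: funpow_add)
  show ?thesis
    unfolding basin_def mem_Collect_eq shift
    using LIMSEQ_ignore_initial_segment[of "\<lambda>m. (R ^^ m) x" r k]
      LIMSEQ_offset[of "\<lambda>m. (R ^^ m) x" k r] by blast
qed

lemma basin_image_iff: "R x \<in> basin R r \<longleftrightarrow> x \<in> basin R r"
  using basin_iterate_iff[of 1 R x r] by simp

lemma attracting_in_basin: 
  assumes "attracting R r" shows "r \<in> basin R r"
  using assms tendsto_uniform_limitI unfolding attracting_def basin_def by fastforce

text \<open>
  A neighbourhood of any point of the basin enters \<open>N\<close> after finitely many steps; later iterates are
  controlled by uniform convergence on \<open>N\<close>, the earlier ones by continuity.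
\<close>

lemma basin_attracting:
  assumes R: "continuous_on UNIV R" and "attracting R r"
  shows "open (basin R r)" "equicontinuous_family_on (basin R r) (iterates R)"
proof -
  obtain N where N: "open N" "r \<in> N" and ul: "uniform_limit N (\<lambda>m. R ^^ m) (\<lambda>_. r) sequentially"
    using assms(2) unfolding attracting_def by blast
  note cont = continuous_on_funpow[OF R]
  have opn: "open ((R ^^ m) -` N)" for m
    using cont N(1) by (simp add: continuous_on_open_vimage)
  have enter: "\<exists>k. (R ^^ k) x \<in> N" if "x \<in> basin R r" for x
  proof -
    have "eventually (\<lambda>m. (R ^^ m) x \<in> N) sequentially"
      using that topological_tendstoD[OF _ N] unfolding basin_def by blast
    then show ?thesis
      using eventually_happens by fastforce
  qed
  have attr: "x \<in> basin R r" if "x \<in> N" for x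
    using tendsto_uniform_limitI[OF ul that] by (simp add: basin_def)
  have "basin R r = (\<Union>m. (R ^^ m) -` N)"
  proof (intro equalityI subsetI)
    fix x assume "x \<in> (\<Union>m. (R ^^ m) -` N)"
    then obtain m where "(R ^^ m) x \<in> N"
      by auto
    then show "x \<in> basin R r"
      using attr basin_iterate_iff by metis
  qed (use enter in auto)
  then show "open (basin R r)"
    using opn by auto
  show "equicontinuous_family_on (basin R r) (iterates R)"
    unfolding equicontinuous_family_on_def
  proof (intro ballI allI impI)
    fix x and e :: real
    assume "x \<in> basin R r" and e: "e > 0"
    then obtain k where k: "(R ^^ k) x \<in> N"
      using enter by blast
    obtain M where M: "\<And>m y. m \<ge> M \<Longrightarrow> y \<in> N \<Longrightarrow> dist ((R ^^ m) y) r < e / 2"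
      using uniform_limitD[OF ul, of "e / 2"] e unfolding eventually_sequentially by (auto simp del: funpow.simps)
    have "eventually (\<lambda>y. dist ((R ^^ m) y) ((R ^^ m) x) < e) (nhds x)" for m
      using cont[of m] e by (intro tendstoD) (simp_all add: continuous_on_def tendsto_at_iff_tendsto_nhds)
    then have "eventually (\<lambda>y. \<forall>m\<in>{..<M + k}. dist ((R ^^ m) y) ((R ^^ m) x) < e) (nhds x)"
      by (intro eventually_ball_finite) auto
    moreover have "eventually (\<lambda>y. (R ^^ k) y \<in> N) (nhds x)"
      using opn[of k] k unfolding eventually_nhds by (intro exI[of _ "(R ^^ k) -` N"]) auto
    ultimately have "eventually (\<lambda>y. \<forall>m. dist ((R ^^ m) y) ((R ^^ m) x) < e) (nhds x)"
    proof eventually_elim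
      case (elim y)
      show ?case
      proof
        fix m
        show "dist ((R ^^ m) y) ((R ^^ m) x) < e"
        proof (cases "m < M + k")
          case False
          have "(R ^^ m) w = (R ^^ (m - k)) ((R ^^ k) w)" for w
            using False funpow_add[of "m - k" k R] by simp
          moreover have "M \<le> m - k"
            using False by simp
          ultimately have "dist ((R ^^ m) y) r < e / 2" "dist ((R ^^ m) x) r < e / 2"
            using M elim(2) k by metis+
          then show ?thesis
            using dist_triangle2[of "(R ^^ m) y" "(R ^^ m) x" r] by simp
        qed (use elim in auto)
      qed
    qed
    then show "\<exists>d>0. \<forall>y\<in>basin R r. dist y x < d \<longrightarrow> (\<forall>f\<in>iterates R. dist (f y) (f x) < e)"
      unfolding eventually_nhds_metric iterates_def by blast
  qed
qed

text \<open>
  Since the basins are open and invariant, the orbit of a point outside them keeps a distance \<open>e\<close> from the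
  attracting points. Arbitrarily close to it there are points whose orbits converge to one of them, so the
  iterates are not equicontinuous there.
\<close>

theorem fatou_set_eq_basins:
  fixes R :: "'a::metric_space \<Rightarrow> 'a"
  assumes R: "continuous_on UNIV R" and I: "finite I" "\<And>r. r \<in> I \<Longrightarrow> attracting R r"
    and dense: "\<And>U. open U \<Longrightarrow> U \<noteq> {} \<Longrightarrow> U \<inter> (\<Union>r\<in>I. basin R r) \<noteq> {}"
  shows "fatou_set R = (\<Union>r\<in>I. basin R r)"
proof
  define B where "B = (\<Union>r\<in>I. basin R r)"
  show "(\<Union>r\<in>I. basin R r) \<subseteq> fatou_set R"
    using basin_attracting[OF R I(2)] fatou_set_greatest(3) by blast
  have "open B"
    using basin_attracting[OF R I(2)] by (auto simp: B_def)
  have "\<exists>e>0. ball r e \<subseteq> B" if "r \<in> I" for r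
    using attracting_in_basin[OF I(2)] that \<open>open B\<close> unfolding B_def open_contains_ball by blast
  then obtain \<epsilon> where \<epsilon>: "\<And>r. r \<in> I \<Longrightarrow> \<epsilon> r > 0" "\<And>r. r \<in> I \<Longrightarrow> ball r (\<epsilon> r) \<subseteq> B"
    by metis
  have "\<exists>e>0. \<forall>r\<in>I. ball r e \<subseteq> B"
  proof (cases "I = {}")
    case False
    then show ?thesis
      using \<epsilon> I(1) by (intro exI[of _ "Min (\<epsilon> ` I)"]) (auto simp: subset_iff)
  qed (auto intro: zero_less_one)
  then obtain e where e: "e > 0" "\<And>r. r \<in> I \<Longrightarrow> ball r e \<subseteq> B"
    by blast
  show "fatou_set R \<subseteq> (\<Union>r\<in>I. basin R r)"
  proof
    fix x assume x: "x \<in> fatou_set R"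
    obtain d where d: "d > 0" "\<And>y m. y \<in> fatou_set R \<Longrightarrow> dist y x < d \<Longrightarrow> dist ((R ^^ m) y) ((R ^^ m) x) < e / 2"
      using fatou_set_greatest(2)[of R] x e(1) unfolding equicontinuous_family_on_def iterates_def
      by (metis half_gt_zero rangeI)
    have "fatou_set R \<inter> ball x d \<inter> (\<Union>r\<in>I. basin R r) \<noteq> {}"
    proof (rule dense)
      show "open (fatou_set R \<inter> ball x d)" "fatou_set R \<inter> ball x d \<noteq> {}"
        using x d(1) fatou_set_greatest(1) by auto
    qed
    then obtain y r where "y \<in> fatou_set R \<inter> ball x d" "r \<in> I" "y \<in> basin R r"
      by blast
    then have y: "y \<in> fatou_set R" "dist y x < d" "r \<in> I" "y \<in> basin R r"
      by (simp_all add: dist_commute)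
    then have "(\<lambda>m. (R ^^ m) y) \<longlonglongrightarrow> r"
      by (simp add: basin_def)
    from tendstoD[OF this, of "e / 2"] obtain m where "dist ((R ^^ m) y) r < e / 2"
      using e(1) by (auto simp: eventually_sequentially)
    then have "dist r ((R ^^ m) x) < e"
      using d(2)[OF y(1,2), of m] dist_triangle_half_r[of "(R ^^ m) y" r e "(R ^^ m) x"] by simp
    then have "(R ^^ m) x \<in> B"
      using e(2)[OF y(3)] by (metis mem_ball subsetD)
    then show "x \<in> (\<Union>r\<in>I. basin R r)"
      using basin_iterate_iff[of m R x] by (auto simp: B_def)
  qed
qed

section \<open>The Riemann sphere in the coordinate \<open>1 / z\<close>\<close>

lemma tendsto_sphere_iff: "(g \<longlongrightarrow> l) F \<longleftrightarrow> ((\<lambda>x. stereo (g x)) \<longlongrightarrow> stereo l) F"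
  by (simp add: tendsto_iff dist_riemann_sphere_def)

lemma continuous_on_sphere_iff: "continuous_on S g \<longleftrightarrow> continuous_on S (\<lambda>x. stereo (g x))"
  by (simp add: continuous_on_def tendsto_sphere_iff)

lemma continuous_on_stereo: "continuous_on S stereo"
  using continuous_on_sphere_iff[of S "\<lambda>x. x"] by simp

lemma continuous_on_Fin: "continuous_on S Fin"
  unfolding continuous_on_sphere_iff stereo.simps
  by (intro continuous_intros) (auto simp: norm_sq_plus_1_neq_0)

text \<open>
  The inverse of the coordinate \<open>u = 1 / z\<close>; it misses only the point \<open>z = 0\<close>.
\<close>

definition chart :: "complex \<Rightarrow> riemann_sphere" where
  "chart u = (if u = 0 then Infty else Fin (1 / u))"

lemma stereo_chart:
  "stereo (chart u) = (cnj ((2 / ((cmod u)\<^sup>2 + 1)) *\<^sub>R u), (1 - (cmod u)\<^sup>2) / ((cmod u)\<^sup>2 + 1))"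
proof (cases "u = 0")
  case False
  define s where "s = (cmod u)\<^sup>2"
  have s: "s > 0"
    using False by (simp add: s_def)
  have inv: "1 / u = cnj u /\<^sub>R s"
    using False complex_norm_square[of u]
    by (simp add: s_def scaleR_conv_of_real field_simps)
  have "(cmod (1 / u))\<^sup>2 = 1 / s"
    by (simp add: s_def norm_divide power_divide)
  moreover have "2 / (1 / s + 1) * inverse s = 2 / (s + 1)" "(1 / s - 1) / (1 / s + 1) = (1 - s) / (s + 1)"
    using s by (simp_all add: field_simps)
  ultimately show ?thesis
    using False inv by (simp add: chart_def s_def[symmetric])
qed (simp add: chart_def)

lemma continuous_on_chart: "continuous_on S chart"
  unfolding continuous_on_sphere_iff stereo_chart
  by (intro continuous_intros) (auto simp: norm_sq_plus_1_neq_0)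

lemma chart_neq_Fin_0 [simp]: "chart u \<noteq> Fin 0" "Fin 0 \<noteq> chart u"
  by (simp_all add: chart_def)

text \<open>
  Stereographic projection from \<open>Fin 0\<close>, conjugated so that it inverts \<open>chart\<close>.
\<close>

definition coord :: "riemann_sphere \<Rightarrow> complex" where
  "coord p = cnj (fst (stereo p)) /\<^sub>R (1 + snd (stereo p))"

lemma coord_chart [simp]: "coord (chart u) = u"
proof -
  define s where "s = (cmod u)\<^sup>2 + 1"
  have s: "s > 0" by (simp add: s_def add_nonneg_pos)
  have "1 + (1 - (cmod u)\<^sup>2) / s = 2 / s"
    using s by (simp add: s_def field_simps)
  then show ?thesis
    using s by (simp add: coord_def stereo_chart s_def[symmetric])
qed

lemma sphere_cases: obtains "p = Fin 0" | u where "p = chart u"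
proof (cases p)
  case (Fin z)
  then show ?thesis
    using that(1) that(2)[of "1 / z"] by (cases "z = 0") (auto simp: chart_def)
next
  case Infty
  then show ?thesis
    using that(2)[of 0] by (simp add: chart_def)
qed

lemma chart_eq_iff [simp]: "chart u = chart v \<longleftrightarrow> u = v"
  by (metis coord_chart)

lemma open_not_Fin_0: "open {p. p \<noteq> Fin 0}"
proof -
  have "{p. p \<noteq> Fin 0} = - {Fin 0}"
    by auto
  then show ?thesis
    using open_Compl[OF closed_singleton[of "Fin 0"]] by simp
qed

lemma continuous_on_coord: "continuous_on {p. p \<noteq> Fin 0} coord"
proof -
  have "1 + snd (stereo p) \<noteq> 0" if "p \<noteq> Fin 0" for p
  proof (cases p rule: sphere_cases)
    case (2 u)
    have "(cmod u)\<^sup>2 + 1 > 0" by (simp add: add_nonneg_pos)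
    then show ?thesis
      by (simp add: 2 stereo_chart field_simps)
  qed (use that in simp)
  then show ?thesis
    unfolding coord_def by (intro continuous_intros continuous_on_stereo) auto
qed

lemma chart_image: "chart ` U = {p. p \<noteq> Fin 0} \<inter> coord -` U"
proof (rule set_eqI)
  fix p
  show "p \<in> chart ` U \<longleftrightarrow> p \<in> {p. p \<noteq> Fin 0} \<inter> coord -` U"
    by (cases p rule: sphere_cases) auto
qed

lemma open_chart_image: "open U \<Longrightarrow> open (chart ` U)"
  unfolding chart_image
  by (intro continuous_open_preimage continuous_on_coord open_not_Fin_0)

lemma tendsto_chart_iff:
  "((\<lambda>x. chart (g x)) \<longlongrightarrow> chart l) F \<longleftrightarrow> (g \<longlongrightarrow> l) F"
proof
  assume "((\<lambda>x. chart (g x)) \<longlongrightarrow> chart l) F"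
  moreover have "isCont coord (chart l)"
    using continuous_on_coord open_not_Fin_0 continuous_on_eq_continuous_at by force
  ultimately show "(g \<longlongrightarrow> l) F"
    using isCont_tendsto_compose[of "chart l" coord] by fastforce
next
  assume "(g \<longlongrightarrow> l) F"
  then show "((\<lambda>x. chart (g x)) \<longlongrightarrow> chart l) F"
    using continuous_on_chart[of UNIV] isCont_tendsto_compose[of l chart g F]
    by (simp add: continuous_on_eq_continuous_at)
qed

lemma chart_tendsto_Fin_0: "(chart \<longlongrightarrow> Fin 0) at_infinity"
proof -
  have "((\<lambda>u. Fin (inverse u)) \<longlongrightarrow> Fin 0) at_infinity"
    using continuous_on_Fin[of UNIV] tendsto_inverse_0
    by (intro continuous_on_tendsto_compose[of UNIV Fin inverse]) auto
  moreover have "eventually (\<lambda>u. chart u = Fin (inverse u)) at_infinity"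
    unfolding eventually_at_infinity by (intro exI[of _ 1]) (auto simp: chart_def field_simps)
  ultimately show ?thesis
    using tendsto_cong by fast
qed

text \<open>
  A neighbourhood base of \<open>Fin 0\<close>; the complement of a compact set is a form whose openness is immediate.
\<close>

definition outer :: "real \<Rightarrow> riemann_sphere set" where
  "outer B = - chart ` cball 0 B"

lemma open_outer: "open (outer B)"
  unfolding outer_def
  by (intro open_Compl compact_imp_closed compact_continuous_image continuous_on_chart compact_cball)

lemma Fin_0_in_outer [simp]: "Fin 0 \<in> outer B"
  by (auto simp: outer_def)

lemma chart_in_outer [simp]: "chart u \<in> outer B \<longleftrightarrow> cmod u > B"
  by (auto simp: outer_def)

lemma outer_near_Fin_0:
  assumes "e > 0"
  obtains B where "\<And>p. p \<in> outer B \<Longrightarrow> dist p (Fin 0) < e"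
proof -
  obtain B where B: "\<And>u. cmod u \<ge> B \<Longrightarrow> dist (chart u) (Fin 0) < e"
    using tendstoD[OF chart_tendsto_Fin_0 assms] unfolding eventually_at_infinity by blast
  have "dist p (Fin 0) < e" if "p \<in> outer B" for p
    using that B assms by (cases p rule: sphere_cases) auto
  then show thesis
    using that by blast
qed

section \<open>Rational maps with attracted critical points\<close>

text \<open>
  The map is \<open>P / Q\<close> in the coordinate \<open>u = 1 / z\<close>. Growth outside the disc of radius \<open>\<rho>\<close> expresses that
  \<open>z = 0\<close> is attracting, and it makes the complement of its basin bounded in this coordinate.
\<close>

locale attracting_origin_map =
  fixes R :: "riemann_sphere \<Rightarrow> riemann_sphere" and P Q :: "complex poly" and \<rho> :: real
  assumes R_Fin_0: "R (Fin 0) = Fin 0"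
    and R_chart: "\<And>u. R (chart u) = (if poly Q u = 0 then Fin 0 else chart (poly P u / poly Q u))"
    and coprime: "\<And>u. poly Q u = 0 \<Longrightarrow> poly P u \<noteq> 0"
    and degree: "degree Q < degree P"
    and rho_pos: "\<rho> > 0"
    and outside: "\<And>u. cmod u \<ge> \<rho> \<Longrightarrow> poly Q u \<noteq> 0"
      "\<And>u. cmod u \<ge> \<rho> \<Longrightarrow> cmod (poly P u / poly Q u) \<ge> 2 * cmod u"
begin

text \<open>
  At a pole the value stands in for infinity. Any number of modulus at least \<open>\<rho>\<close> would serve, since orbits
  that have left the disc of radius \<open>\<rho>\<close> never return to it.
\<close>

definition f :: "complex \<Rightarrow> complex" where
  "f u = (if poly Q u = 0 then of_real \<rho> else poly P u / poly Q u)"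

definition wronskian :: "complex poly" where
  "wronskian = pderiv P * Q - P * pderiv Q"

lemma f_regular: "poly Q u \<noteq> 0 \<Longrightarrow> f u = poly P u / poly Q u"
  by (simp add: f_def)

lemma f_grows: "cmod u \<ge> \<rho> \<Longrightarrow> cmod (f u) \<ge> 2 * cmod u"
  using outside by (simp add: f_def)

lemma iterate_f_grows: "cmod u \<ge> \<rho> \<Longrightarrow> cmod ((f ^^ m) u) \<ge> 2 ^ m * cmod u"
proof (induction m)
  case (Suc m)
  have "1 * cmod u \<le> 2 ^ m * cmod u"
    by (intro mult_right_mono) auto
  then have "cmod ((f ^^ m) u) \<ge> \<rho>"
    using Suc by simp
  then show ?case
    using f_grows[of "(f ^^ m) u"] Suc by simp
qed simp

lemma iterate_f_outside: "cmod u \<ge> \<rho> \<Longrightarrow> cmod ((f ^^ m) u) \<ge> \<rho>"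
proof -
  assume u: "cmod u \<ge> \<rho>"
  have "1 * cmod u \<le> 2 ^ m * cmod u"
    by (intro mult_right_mono) auto
  then show ?thesis
    using iterate_f_grows[OF u, of m] u by simp
qed

lemma R_chart_regular: "poly Q u \<noteq> 0 \<Longrightarrow> R (chart u) = chart (f u)"
  by (simp add: R_chart f_def)

lemma R_chart_or_outside: "R ((chart u)) = chart (f u) \<or> cmod (f u) \<ge> \<rho>"
  using rho_pos by (auto simp: R_chart f_def)

text \<open>
  The orbits in the plane and on the sphere agree as long as the disc of radius \<open>\<rho>\<close> is not left; a pole is
  the only place where they separate.
\<close>

lemma iterate_chart_or_outside: "(R ^^ m) (chart u) = chart ((f ^^ m) u) \<or> cmod ((f ^^ m) u) \<ge> \<rho>"
proof (induction m)
  case (Suc m)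
  show ?case
  proof (cases "cmod ((f ^^ m) u) \<ge> \<rho>")
    case True
    then show ?thesis
      using iterate_f_outside[of "(f ^^ m) u" 1] by simp
  next
    case False
    then show ?thesis
      using Suc R_chart_or_outside[of "(f ^^ m) u"] by auto
  qed
qed simp

lemma iterate_chart_outside: "cmod u \<ge> \<rho> \<Longrightarrow> (R ^^ m) (chart u) = chart ((f ^^ m) u)"
proof (induction m)
  case (Suc m)
  then show ?case
    using R_chart_regular[of "(f ^^ m) u"] outside(1) iterate_f_outside by simp
qed simp

lemma R_outer:
  assumes "B \<ge> \<rho>" "p \<in> outer B"
  shows "R p \<in> outer B"
proof (cases p rule: sphere_cases)
  case (2 u)
  then have u: "cmod u > B" using assms by simp
  then have "cmod (f u) > B"
    using f_grows[of u] assms(1) rho_pos by simp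
  moreover have "poly Q u \<noteq> 0"
    using outside(1) u assms(1) by simp
  ultimately show ?thesis
    using 2 R_chart_regular by simp
qed (simp add: R_Fin_0)

lemma continuous_R: "continuous_on UNIV R"
proof (rule continuous_at_imp_continuous_on, rule ballI)
  fix p :: riemann_sphere
  show "isCont R p"
  proof (cases p rule: sphere_cases)
    case 1
    have "(R \<longlongrightarrow> Fin 0) (nhds (Fin 0))"
    proof (rule tendstoI)
      fix e :: real assume "e > 0"
      then obtain B where B: "\<And>p. p \<in> outer B \<Longrightarrow> dist p (Fin 0) < e"
        using outer_near_Fin_0 by blast
      define B' where "B' = max B \<rho>"
      have "outer B' \<subseteq> outer B"
        by (auto simp: outer_def B'_def)
      then have "dist (R p) (Fin 0) < e" if "p \<in> outer B'" for p
        using R_outer[of B' p] that B by (auto simp: B'_def)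
      then show "eventually (\<lambda>p. dist (R p) (Fin 0) < e) (nhds (Fin 0))"
        unfolding eventually_nhds by (intro exI[of _ "outer B'"]) (simp add: open_outer)
    qed
    then show ?thesis
      by (simp add: 1 isCont_def R_Fin_0 tendsto_nhds_iff)
  next
    case (2 u)
    show ?thesis
    proof (cases "poly Q u = 0")
      case False
      let ?S = "chart ` {u. poly Q u \<noteq> 0}"
      have "open ?S"
        by (intro open_chart_image open_Collect_neq continuous_intros)
      moreover have "continuous_on ?S (\<lambda>p. chart (poly P (coord p) / poly Q (coord p)))"
        by (intro continuous_on_compose2[OF continuous_on_chart[of UNIV]] continuous_intros
            continuous_on_subset[OF continuous_on_coord]) auto
      then have "continuous_on ?S R"
        by (rule continuous_on_eq) (auto simp: R_chart)
      ultimately show ?thesis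
        using False by (auto simp: 2 continuous_on_eq_continuous_at)
    next
      case True
      let ?S = "chart ` {u. poly P u \<noteq> 0}"
      have "open ?S"
        by (intro open_chart_image open_Collect_neq continuous_intros)
      moreover have "continuous_on ?S (\<lambda>p. Fin (poly Q (coord p) / poly P (coord p)))"
        by (intro continuous_on_compose2[OF continuous_on_Fin[of UNIV]] continuous_intros
            continuous_on_subset[OF continuous_on_coord]) auto
      then have "continuous_on ?S R"
        by (rule continuous_on_eq) (auto simp: R_chart chart_def[of "poly P _ / poly Q _"])
      ultimately show ?thesis
        using coprime[OF True] by (auto simp: 2 continuous_on_eq_continuous_at)
    qed
  qed
qed

lemma attracting_Fin_0: "attracting R (Fin 0)"
  unfolding attracting_def
proof (intro exI[of _ "outer \<rho>"] conjI open_outer Fin_0_in_outer uniform_limitI)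
  fix e :: real assume "e > 0"
  then obtain B where B: "\<And>p. p \<in> outer B \<Longrightarrow> dist p (Fin 0) < e"
    using outer_near_Fin_0 by blast
  obtain M where M: "B < 2 ^ M * \<rho>"
    using rho_pos real_arch_pow[of 2 "B / \<rho>"] by (auto simp: field_simps)
  have "dist ((R ^^ m) p) (Fin 0) < e" if "m \<ge> M" "p \<in> outer \<rho>" for m p
  proof (cases p rule: sphere_cases)
    case 1
    have "(R ^^ m) (Fin 0) = Fin 0"
      by (induction m) (simp_all add: R_Fin_0)
    then show ?thesis
      using 1 \<open>e > 0\<close> by simp
  next
    case (2 u)
    then have u: "cmod u > \<rho>" using that by simp
    have "2 ^ M * \<rho> \<le> 2 ^ m * cmod u"
      using that u rho_pos by (intro mult_mono power_increasing) auto
    then have "cmod ((f ^^ m) u) > B"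
      using M iterate_f_grows[of u m] u by simp
    then show ?thesis
      using B[of "chart ((f ^^ m) u)"] iterate_chart_outside[of u m] u 2 by simp
  qed
  then show "eventually (\<lambda>m. \<forall>p\<in>outer \<rho>. dist ((R ^^ m) p) (Fin 0) < e) sequentially"
    unfolding eventually_sequentially by blast
qed

lemma outside_in_basin: "cmod u \<ge> \<rho> \<Longrightarrow> chart u \<in> basin R (Fin 0)"
proof -
  assume u: "cmod u \<ge> \<rho>"
  have "filterlim (\<lambda>m. 2 ^ m :: real) at_top sequentially"
    by (rule filterlim_at_top_mono[OF filterlim_real_sequentially])
      (simp add: eventually_sequentially less_imp_le of_nat_less_two_power)
  then have "filterlim (\<lambda>m. 2 ^ m * cmod u) at_top sequentially"
    using u rho_pos by (intro filterlim_at_top_mult_tendsto_pos[of _ "cmod u"]) auto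
  then have "filterlim (\<lambda>m. cmod ((f ^^ m) u)) at_top sequentially"
    using iterate_f_grows[OF u] by (auto elim!: filterlim_at_top_mono)
  then have "filterlim (\<lambda>m. (f ^^ m) u) at_infinity sequentially"
    by (rule filterlim_norm_at_top_imp_at_infinity)
  then have "(\<lambda>m. chart ((f ^^ m) u)) \<longlonglongrightarrow> Fin 0"
    by (rule filterlim_compose[OF chart_tendsto_Fin_0])
  then show ?thesis
    using iterate_chart_outside[OF u] by (simp add: basin_def)
qed

lemma f_derivative:
  assumes "poly Q u \<noteq> 0"
  shows "(f has_field_derivative poly wronskian u / (poly Q u)\<^sup>2) (at u)"
proof (rule has_field_derivative_transform_within_open[of _ _ _ "{u. poly Q u \<noteq> 0}"])
  show "((\<lambda>u. poly P u / poly Q u) has_field_derivative poly wronskian u / (poly Q u)\<^sup>2) (at u)"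
    using assms by (auto intro!: derivative_eq_intros simp: power2_eq_square wronskian_def)
qed (use assms f_regular in \<open>auto intro!: open_Collect_neq continuous_intros\<close>)

text \<open>
  The derivative of \<open>f\<close> vanishes at \<open>\<zeta>\<close>, so near \<open>\<zeta>\<close> the map halves distances to \<open>\<zeta>\<close>.
\<close>

lemma attracting_chart:
  assumes "poly Q \<zeta> \<noteq> 0" "f \<zeta> = \<zeta>" "poly wronskian \<zeta> = 0"
  shows "attracting R (chart \<zeta>)"
proof -
  have "((\<lambda>u. (f u - f \<zeta>) / (u - \<zeta>)) \<longlongrightarrow> 0) (at \<zeta>)"
    using f_derivative[OF assms(1)] assms(3) by (simp add: has_field_derivative_iff)
  from tendstoD[OF this, of "1/2"] have "eventually (\<lambda>u. cmod ((f u - f \<zeta>) / (u - \<zeta>)) < 1/2) (at \<zeta>)"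
    by simp
  moreover have "eventually (\<lambda>u. poly Q u \<noteq> 0) (at \<zeta>)"
    by (rule tendsto_imp_eventually_ne[OF _ assms(1)]) (intro tendsto_intros)
  ultimately have "eventually (\<lambda>u. cmod ((f u - f \<zeta>) / (u - \<zeta>)) < 1/2 \<and> poly Q u \<noteq> 0) (at \<zeta>)"
    by (rule eventually_conj)
  then obtain d where d: "d > 0" "\<And>u. u \<noteq> \<zeta> \<Longrightarrow> dist u \<zeta> < d \<Longrightarrow>
      cmod ((f u - f \<zeta>) / (u - \<zeta>)) < 1/2 \<and> poly Q u \<noteq> 0"
    unfolding eventually_at by blast
  have contract: "dist (f u) \<zeta> \<le> dist u \<zeta> / 2" "poly Q u \<noteq> 0" if "dist u \<zeta> < d" for u
    using d(2)[of u] that assms by (cases "u = \<zeta>"; force simp: dist_norm norm_divide field_simps)+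
  have iter: "(R ^^ m) (chart u) = chart ((f ^^ m) u) \<and> dist ((f ^^ m) u) \<zeta> \<le> dist u \<zeta> / 2 ^ m"
    if u: "dist u \<zeta> < d" for u m
  proof (induction m)
    case (Suc m)
    have "dist u \<zeta> / 2 ^ m \<le> dist u \<zeta> / 1"
      by (intro divide_left_mono) auto
    then have "dist ((f ^^ m) u) \<zeta> < d"
      using Suc u by simp
    then show ?case
      using contract[of "(f ^^ m) u"] Suc R_chart_regular[of "(f ^^ m) u"] by simp
  qed simp
  show ?thesis
    unfolding attracting_def
  proof (intro exI[of _ "chart ` ball \<zeta> d"] conjI open_chart_image open_ball uniform_limitI)
    fix e :: real assume "e > 0"
    have "isCont chart \<zeta>"
      using continuous_on_chart[of UNIV] by (simp add: continuous_on_eq_continuous_at)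
    then obtain \<delta> where \<delta>: "\<delta> > 0" "\<And>u. dist u \<zeta> < \<delta> \<Longrightarrow> dist (chart u) (chart \<zeta>) < e"
      using \<open>e > 0\<close> unfolding continuous_at_eps_delta by blast
    obtain M where M: "d / \<delta> < 2 ^ M"
      using real_arch_pow[of 2 "d / \<delta>"] by auto
    have "dist ((R ^^ m) p) (chart \<zeta>) < e" if "m \<ge> M" and p: "p \<in> chart ` ball \<zeta> d" for m p
    proof -
      obtain u where u: "p = chart u" "dist u \<zeta> < d"
        using p by (auto simp: dist_commute)
      have "d < \<delta> * 2 ^ M"
        using M \<delta>(1) by (simp add: field_simps)
      also have "\<dots> \<le> \<delta> * 2 ^ m"
        using that \<delta>(1) by (intro mult_left_mono power_increasing) auto
      finally have "dist u \<zeta> / 2 ^ m < \<delta>"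
        using u(2) by (simp add: field_simps)
      then show ?thesis
        using iter[OF u(2), of m] \<delta>(2)[of "(f ^^ m) u"] u(1) by simp
    qed
    then show "eventually (\<lambda>m. \<forall>p\<in>chart ` ball \<zeta> d. dist ((R ^^ m) p) (chart \<zeta>) < e) sequentially"
      unfolding eventually_sequentially by blast
  qed (use d in auto)
qed

text \<open>
  Either the orbit leaves the disc of radius \<open>\<rho>\<close>, and only finitely many of its points are new, or it
  converges to a point of \<open>Z\<close>.
\<close>

lemma closed_exterior_Un_orbit:
  assumes "chart c \<in> (\<Union>r\<in>insert (Fin 0) (chart ` Z). basin R r)" "finite Z"
  shows "closed ({u. cmod u \<ge> \<rho>} \<union> Z \<union> range (\<lambda>m. (f ^^ Suc m) c))"
proof -
  let ?S = "{u. cmod u \<ge> \<rho>} \<union> Z" and ?s = "\<lambda>m. (f ^^ Suc m) c"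
  have closed: "closed ?S"
    using assms(2) by (intro closed_Un finite_imp_closed closed_Collect_le continuous_intros)
  have *: "closed (?S \<union> range ?s)" if "\<And>m. m \<ge> N \<Longrightarrow> (f ^^ m) c \<in> ?S" for N
  proof -
    have "?S \<union> range ?s = ?S \<union> ?s ` {..<N}"
      using that by (auto simp del: funpow.simps simp: image_iff) (metis Suc_n_not_le_n leI le_SucI lessThan_iff)+
    then show ?thesis
      using closed by (metis closed_Un finite_imageI finite_imp_closed finite_lessThan)
  qed
  show ?thesis
  proof (cases "\<exists>N. cmod ((f ^^ N) c) \<ge> \<rho>")
    case True
    then obtain N where N: "cmod ((f ^^ N) c) \<ge> \<rho>" by blast
    have "(f ^^ m) c \<in> ?S" if "m \<ge> N" for m
      using iterate_f_outside[OF N, of "m - N"] that by (simp flip: funpow_add[THEN fun_cong, unfolded o_apply])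
    then show ?thesis
      by (rule *)
  next
    case False
    then have eq: "(R ^^ m) (chart c) = chart ((f ^^ m) c)" for m
      using iterate_chart_or_outside by blast
    have "chart c \<notin> basin R (Fin 0)"
    proof
      assume "chart c \<in> basin R (Fin 0)"
      then have "(\<lambda>m. chart ((f ^^ m) c)) \<longlonglongrightarrow> Fin 0"
        by (simp add: basin_def eq)
      then have "eventually (\<lambda>m. chart ((f ^^ m) c) \<in> outer \<rho>) sequentially"
        by (rule topological_tendstoD[OF _ open_outer Fin_0_in_outer])
      then show False
        using False by (auto simp: eventually_sequentially) (metis less_imp_le order_refl)
    qed
    then obtain \<zeta> where \<zeta>: "\<zeta> \<in> Z" "chart c \<in> basin R (chart \<zeta>)"
      using assms(1) by auto
    then have "(\<lambda>m. (f ^^ m) c) \<longlonglongrightarrow> \<zeta>"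
      by (simp add: basin_def eq tendsto_chart_iff)
    then have "?s \<longlonglongrightarrow> \<zeta>"
      by (rule LIMSEQ_Suc)
    then have "closed (insert \<zeta> (range ?s))"
      by (intro compact_imp_closed compact_sequence_with_limit)
    then have "closed (?S \<union> insert \<zeta> (range ?s))"
      by (rule closed_Un[OF closed])
    moreover have "?S \<union> insert \<zeta> (range ?s) = ?S \<union> range ?s"
      using \<zeta>(1) by auto
    ultimately show ?thesis
      by simp
  qed
qed

text \<open>
  The set \<open>A\<close> below consists of the exterior of the disc, the attracting points and the forward orbits of
  the nonzero critical values. It is closed and forward invariant, so \<open>f\<close> is a covering over the complement
  \<open>\<Omega>\<close> of \<open>A\<close> and \<open>0\<close>; critical points over \<open>0\<close> are harmless because \<open>0\<close> is left out. The set \<open>A\<close> lies in the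
  basins, so the complement \<open>K\<close> of the basins has no interior by the result on \<open>covering_dynamics\<close>, and
  the basins are dense.
\<close>

theorem fatou_set_eq_of_attracted_critical_points:
  assumes Z: "finite Z" "\<And>\<zeta>. \<zeta> \<in> Z \<Longrightarrow> poly Q \<zeta> \<noteq> 0 \<and> poly P \<zeta> = \<zeta> * poly Q \<zeta> \<and> poly wronskian \<zeta> = 0"
    and zero: "poly P 0 = 0" "poly Q 0 \<noteq> 0" "cmod (poly (pderiv P) 0 / poly Q 0) > 1"
    and critical: "\<And>c. poly wronskian c = 0 \<Longrightarrow> poly Q c \<noteq> 0 \<Longrightarrow> poly P c \<noteq> 0 \<Longrightarrow>
                     chart c \<in> (\<Union>r\<in>insert (Fin 0) (chart ` Z). basin R r)"
  shows "fatou_set R = (\<Union>r\<in>insert (Fin 0) (chart ` Z). basin R r)"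
proof -
  define I where "I = insert (Fin 0) (chart ` Z)"
  define B where "B = (\<Union>r\<in>I. basin R r)"
  define C where "C = {c. poly wronskian c = 0 \<and> poly Q c \<noteq> 0 \<and> poly P c \<noteq> 0}"
  define A where "A = {u. cmod u \<ge> \<rho>} \<union> Z \<union> (\<Union>c\<in>C. range (\<lambda>m. (f ^^ Suc m) c))"
  define \<Omega> where "\<Omega> = - (insert 0 A)"
  define K where "K = {u. chart u \<notin> B}"
  have fixZ: "f \<zeta> = \<zeta>" if "\<zeta> \<in> Z" for \<zeta>
    using Z(2)[OF that] by (simp add: f_def)
  have f0: "f 0 = 0"
    using zero by (simp add: f_def)
  have W0: "poly wronskian 0 = poly (pderiv P) 0 * poly Q 0"
    using zero by (simp add: wronskian_def)
  have W0': "poly wronskian 0 \<noteq> 0"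
    using zero by (auto simp: W0)
  then have "finite {c. poly wronskian c = 0}"
    by (intro poly_roots_finite) auto
  then have finC: "finite C"
    unfolding C_def by (rule finite_subset[rotated]) auto
  have attr: "attracting R r" if "r \<in> I" for r
    using that attracting_Fin_0 attracting_chart Z(2) fixZ by (auto simp: I_def)
  have finI: "finite I"
    using Z(1) by (simp add: I_def)
  have openB: "open B"
    using basin_attracting(1)[OF continuous_R attr] by (auto simp: B_def)
  have RB: "R p \<in> B \<longleftrightarrow> p \<in> B" for p
    by (auto simp: B_def basin_image_iff)
  have RBm: "(R ^^ m) p \<in> B \<longleftrightarrow> p \<in> B" for m p
    by (auto simp: B_def basin_iterate_iff)
  have outB: "chart u \<in> B" if "cmod u \<ge> \<rho>" for u
    using outside_in_basin[OF that] by (auto simp: B_def I_def)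
  have rootB: "r \<in> B" if "r \<in> I" for r
    using attracting_in_basin[OF attr[OF that]] that by (auto simp: B_def)
  have CB: "chart c \<in> B" if "c \<in> C" for c
    using critical that by (auto simp: B_def I_def C_def)
  have fB: "chart ((f ^^ m) u) \<in> B" if "chart u \<in> B" for m u
    using iterate_chart_or_outside[of m u] RBm[of m "chart u"] outB that by auto
  have "closed A"
  proof -
    have "A = {u. cmod u \<ge> \<rho>} \<union> Z \<union> (\<Union>c\<in>C. {u. cmod u \<ge> \<rho>} \<union> Z \<union> range (\<lambda>m. (f ^^ Suc m) c))"
      by (auto simp: A_def)
    moreover have "closed ({u. cmod u \<ge> \<rho>} \<union> Z)"
      using Z(1) by (intro closed_Un finite_imp_closed closed_Collect_le continuous_intros)
    moreover have "closed (\<Union>c\<in>C. {u. cmod u \<ge> \<rho>} \<union> Z \<union> range (\<lambda>m. (f ^^ Suc m) c))"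
      using critical Z(1) by (intro closed_UN finC closed_exterior_Un_orbit ballI) (auto simp: C_def)
    ultimately show ?thesis
      using closed_Un by metis
  qed
  then have openO: "open \<Omega>"
    unfolding \<Omega>_def by (intro open_Compl closed_insert)
  have fA: "f u \<in> A" if "u \<in> A" for u
  proof -
    consider "cmod u \<ge> \<rho>" | "u \<in> Z" | c m where "c \<in> C" "u = (f ^^ Suc m) c"
      using \<open>u \<in> A\<close> unfolding A_def by blast
    then show ?thesis
    proof cases
      case 1
      then show ?thesis
        using iterate_f_outside[of u 1] by (simp add: A_def)
    next
      case 2
      then show ?thesis
        using fixZ by (simp add: A_def)
    next
      case 3
      then have "f u = (f ^^ Suc (Suc m)) c"
        by simp
      then show ?thesis
        using 3(1) unfolding A_def by blast
    qed
  qed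
  have preim: "f -` \<Omega> \<subseteq> \<Omega>"
    using fA f0 by (auto simp: \<Omega>_def)
  have pole: "f u \<notin> \<Omega>" if "poly Q u = 0" for u
    using that rho_pos by (simp add: \<Omega>_def A_def f_def)
  have reg: "poly (pderiv P * Q - P * pderiv Q) u \<noteq> 0" if "f u \<in> \<Omega>" for u
  proof
    assume "poly (pderiv P * Q - P * pderiv Q) u = 0"
    then have wronskian: "poly wronskian u = 0" by (simp add: wronskian_def)
    have Q: "poly Q u \<noteq> 0"
      using pole that by blast
    have "poly P u \<noteq> 0"
      using that Q by (auto simp: f_def \<Omega>_def)
    then have "u \<in> C"
      using wronskian Q by (simp add: C_def)
    then have "(f ^^ Suc 0) u \<in> A"
      unfolding A_def by blast
    then show False
      using that by (simp add: \<Omega>_def)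
  qed
  note cov = covering_space_rational[OF openO degree coprime f_regular pole reg]
  have KA: "u \<notin> A" if "u \<in> K" for u
  proof
    assume "u \<in> A"
    then consider "cmod u \<ge> \<rho>" | "u \<in> Z" | c m where "c \<in> C" "u = (f ^^ Suc m) c"
      unfolding A_def by blast
    then have "chart u \<in> B"
    proof cases
      case 2
      then show ?thesis using rootB by (simp add: I_def)
    next
      case 3
      then show ?thesis using fB[OF CB, of c "Suc m"] by simp
    qed (use outB in auto)
    then show False
      using that by (simp add: K_def)
  qed
  have KQ: "poly Q u \<noteq> 0" if "u \<in> K" for u
  proof
    assume "poly Q u = 0"
    then have "R (chart u) \<in> B"
      using rootB[of "Fin 0"] by (simp add: R_chart I_def)
    then show False
      using that RB by (simp add: K_def)
  qed
  have "closed K"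
  proof -
    have "open (chart -` B)"
      using openB continuous_on_chart[of UNIV] by (simp add: continuous_on_open_vimage)
    moreover have "K = - (chart -` B)"
      by (auto simp: K_def)
    ultimately show ?thesis
      by (simp add: closed_Compl)
  qed
  have Kball: "K \<subseteq> ball 0 \<rho>"
    using outB by (force simp: K_def)
  have R0: "R (chart 0) = chart 0"
    using R_chart_regular[OF zero(2)] f0 by simp
  have zeroK: "0 \<in> K"
  proof -
    have "chart 0 \<notin> basin R r" if "r \<in> I" for r
    proof
      have "(R ^^ m) (chart 0) = chart 0" for m
        using R0 by (induction m) auto
      moreover assume "chart 0 \<in> basin R r"
      ultimately have "(\<lambda>m::nat. chart 0) \<longlonglongrightarrow> r"
        by (simp add: basin_def)
      then have "r = chart 0"
        by (metis LIMSEQ_unique tendsto_const)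
      then have "0 \<in> Z"
        using that chart_eq_iff[of _ 0] by (auto simp: I_def)
      then show False
        using Z(2)[of 0] W0' by simp
    qed
    then show ?thesis
      by (simp add: K_def B_def)
  qed
  interpret covering_dynamics f \<Omega> K 0
  proof
    show "open \<Omega>" by fact
    show "bounded \<Omega>"
      by (rule bounded_subset[of "ball 0 \<rho>"]) (auto simp: \<Omega>_def A_def)
    show "open (f -` \<Omega>)"
      using cov(1) .
    show "f holomorphic_on f -` \<Omega>"
      using cov(2) .
    show "covering_space (f -` \<Omega>) f \<Omega>"
      using cov(3) .
    show "f -` \<Omega> \<subseteq> \<Omega>" by fact
    show "compact K"
      using \<open>closed K\<close> Kball bounded_subset[OF bounded_ball] compact_eq_bounded_closed by blast
    show "f ` K \<subseteq> K"
    proof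
      fix v assume "v \<in> f ` K"
      then obtain u where "u \<in> K" "v = f u" by blast
      then show "v \<in> K"
        using R_chart_regular[OF KQ, of u] RB[of "chart u"] by (simp add: K_def)
    qed
    show "K \<subseteq> insert 0 \<Omega>"
      using KA by (auto simp: \<Omega>_def)
    have "open {u. poly Q u \<noteq> 0}"
      by (intro open_Collect_neq continuous_intros)
    moreover have "f holomorphic_on {u. poly Q u \<noteq> 0}"
      using f_derivative calculation by (auto simp: holomorphic_on_open)
    ultimately have "f analytic_on {u. poly Q u \<noteq> 0}"
      by (simp add: analytic_on_open)
    then show "f analytic_on K"
      by (rule analytic_on_subset) (use KQ in auto)
    show "eventually (\<lambda>m. (f ^^ m) x \<notin> L) sequentially"
      if x: "x \<in> \<Omega>" "x \<notin> K" and L: "compact L" "L \<subseteq> \<Omega>" for x L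
    proof (cases "\<exists>N. cmod ((f ^^ N) x) \<ge> \<rho>")
      case True
      then obtain N where N: "cmod ((f ^^ N) x) \<ge> \<rho>" by blast
      have "(f ^^ m) x \<notin> L" if "m \<ge> N" for m
      proof -
        have "(f ^^ m) x = (f ^^ (m - N)) ((f ^^ N) x)"
          using funpow_add[of "m - N" N f] that by simp
        then have "(f ^^ m) x \<in> A"
          using iterate_f_outside[OF N, of "m - N"] by (simp add: A_def)
        then show ?thesis
          using L(2) by (auto simp: \<Omega>_def)
      qed
      then show ?thesis
        by (auto simp: eventually_sequentially)
    next
      case False
      then have eq: "(R ^^ m) (chart x) = chart ((f ^^ m) x)" for m
        using iterate_chart_or_outside by blast
      obtain r where r: "r \<in> I" "chart x \<in> basin R r"
        using x(2) by (auto simp: K_def B_def)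
      then have lim: "(\<lambda>m. chart ((f ^^ m) x)) \<longlonglongrightarrow> r"
        by (simp add: basin_def eq)
      have "open (- chart ` L)"
        using L(1) by (intro open_Compl compact_imp_closed compact_continuous_image continuous_on_chart)
      moreover have "r \<in> - chart ` L"
        using r(1) L(2) by (auto simp: I_def \<Omega>_def A_def)
      ultimately have "eventually (\<lambda>m. chart ((f ^^ m) x) \<in> - chart ` L) sequentially"
        using topological_tendstoD[OF lim] by blast
      then show ?thesis
        by (rule eventually_mono) auto
    qed
    show "0 \<in> K" by fact
    show "0 \<notin> \<Omega>" by (simp add: \<Omega>_def)
    show "f 0 = 0" by fact
    have "deriv f 0 = poly (pderiv P) 0 / poly Q 0"
      using DERIV_imp_deriv[OF f_derivative[OF zero(2)]] zero(2) by (simp add: W0 power2_eq_square)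
    then show "norm (deriv f 0) > 1"
      using zero(3) by simp
    have "P \<noteq> 0"
      using degree by auto
    then have "finite {u. poly P u = 0}"
      by (rule poly_roots_finite)
    moreover have "{x \<in> K. f x = 0} \<subseteq> {u. poly P u = 0}"
      using KQ by (auto simp: f_def split: if_splits)
    ultimately show "finite {x \<in> K. f x = 0}"
      by (rule finite_subset[rotated])
  qed
  have "U \<inter> (\<Union>r\<in>I. basin R r) \<noteq> {}" if U: "open U" "U \<noteq> {}" for U
  proof -
    obtain p where p: "p \<in> U" using U by blast
    show ?thesis
    proof (cases p rule: sphere_cases)
      case 1
      then show ?thesis
        using p rootB[of "Fin 0"] by (auto simp: B_def I_def)
    next
      case (2 u)
      have "open (chart -` U)"
        using U(1) continuous_on_chart[of UNIV] by (simp add: continuous_on_open_vimage)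
      moreover have "u \<in> chart -` U"
        using p 2 by simp
      ultimately have "\<not> chart -` U \<subseteq> K"
        using interior_K_empty interior_maximal by blast
      then show ?thesis
        by (auto simp: K_def B_def)
    qed
  qed
  then show ?thesis
    using fatou_set_eq_basins[OF continuous_R finI attr] by (simp add: I_def)
qed

end

section \<open>Chebyshev's method for \<open>z * (z ^ n - 1)\<close>\<close>

text \<open>
  The reduced fraction arises from \<open>A / B\<close> by cancelling a common factor, which has no zeros because \<open>A\<close>
  and \<open>B\<close> have no common zero.
\<close>

lemma sphere_map_quotient:
  fixes A B :: "complex poly"
  assumes B: "B \<noteq> 0" and nz: "\<And>z. poly B z = 0 \<Longrightarrow> poly A z \<noteq> 0"
  shows "sphere_map (to_fract A / to_fract B) (Fin z) =
           (if poly B z = 0 then Infty else Fin (poly A z / poly B z))"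
    and "degree B < degree A \<Longrightarrow> sphere_map (to_fract A / to_fract B) Infty = Infty"
proof -
  define F where "F = to_fract A / to_fract B"
  obtain a b where ab: "quot_of_fract F = (a, b)" by fastforce
  have b: "b \<noteq> 0"
    using snd_quot_of_fract_nonzero[of F] ab by simp
  have cop: "coprime a b"
    using coprime_quot_of_fract[of F] ab by simp
  have "to_fract a / to_fract b = F"
    using Fract_quot_of_fract[of F] ab by (simp add: Fract_conv_to_fract)
  then have "to_fract a * to_fract B = to_fract A * to_fract b"
    using b B by (simp add: F_def field_simps)
  then have eq: "a * B = A * b"
    by (simp flip: to_fract_mult)
  then have eqz: "poly a w * poly B w = poly A w * poly b w" for w
    by (metis poly_mult)
  have "poly a w \<noteq> 0 \<or> poly b w \<noteq> 0" for w
    using coprime_poly_0[OF cop] by blast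
  then have iff: "poly b w = 0 \<longleftrightarrow> poly B w = 0" for w
    using eqz[of w] nz[of w] by auto
  show "sphere_map (to_fract A / to_fract B) (Fin z) =
           (if poly B z = 0 then Infty else Fin (poly A z / poly B z))"
    using eqz[of z] iff[of z]
    by (simp add: sphere_map_def F_def[symmetric] ab field_simps)
  assume deg: "degree B < degree A"
  then have "A \<noteq> 0" by auto
  then have "a \<noteq> 0"
    using eq b by auto
  then have "degree a + degree B = degree A + degree b"
    using eq \<open>A \<noteq> 0\<close> b B by (metis degree_mult_eq)
  then show "sphere_map (to_fract A / to_fract B) Infty = Infty"
    using deg by (simp add: sphere_map_def F_def[symmetric] ab)
qed

lemma chebyshev_step_fract:
  fixes x p p1 p2 :: "'a :: {idom, ring_char_0}"
  assumes "p1 \<noteq> 0"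
  shows "to_fract x - (1 + 1 / 2 * (to_fract p * to_fract p2 / (to_fract p1)\<^sup>2)) * (to_fract p / to_fract p1)
           = to_fract (2 * x * p1 ^ 3 - 2 * p * p1\<^sup>2 - p\<^sup>2 * p2) / to_fract (2 * p1 ^ 3)"
proof -
  have two: "to_fract (2 :: 'a) = 2"
    using to_fract_add[of "1 :: 'a" 1] by simp
  have "(2 :: 'a fract) \<noteq> 0"
    by (simp flip: two)
  moreover have "to_fract p1 \<noteq> 0"
    using assms by simp
  ultimately show ?thesis
    by (simp add: two field_simps power2_eq_square power3_eq_cube)
qed

lemma poly_ext_eq:
  fixes p q :: "complex poly"
  shows "(\<And>x. poly p x = poly q x) \<Longrightarrow> p = q"
  by (simp add: poly_eq_poly_eq_iff[symmetric] fun_eq_iff)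

locale chebyshev_unity =
  fixes n :: nat
  assumes n: "n > 1"
begin

abbreviation N :: complex where "N \<equiv> of_nat n"

definition V :: "complex poly" where "V = [:0, 1:] ^ n"

text \<open>
  \<open>A / B\<close> is Chebyshev's map in the coordinate \<open>z\<close>, and \<open>P / Q\<close> is the same map in the coordinate
  \<open>u = 1 / z\<close>.
\<close>

definition A :: "complex poly" where
  "A = [:0, N:] * V * pcompose [:- (N - 1), - 2 * (N + 1), (N + 1) * (2 * N + 1):] V"

definition B :: "complex poly" where
  "B = 2 * pcompose [:- 1, N + 1:] V ^ 3"

definition P :: "complex poly" where
  "P = [:0, 2:] * pcompose [:N + 1, - 1:] V ^ 3"

definition Q :: "complex poly" where
  "Q = [:N:] * pcompose [:(N + 1) * (2 * N + 1), - 2 * (N + 1), - (N - 1):] V"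

definition R :: "riemann_sphere \<Rightarrow> riemann_sphere" where
  "R = sphere_map (chebyshev (p_poly n))"

lemma degree_V: "degree V = n"
  by (simp add: V_def degree_power_eq)

lemma poly_V: "poly V u = u ^ n"
  by (simp add: V_def)

lemma N_nonzero [simp]: "N \<noteq> 0" "N + 1 \<noteq> 0" "2 * N + 1 \<noteq> 0" "N - 1 \<noteq> 0"
proof -
  show "N \<noteq> 0" using n by simp
  have "of_nat (Suc n) \<noteq> (0 :: complex)" "of_nat (Suc (2 * n)) \<noteq> (0 :: complex)"
    by (rule of_nat_neq_0)+
  then show "N + 1 \<noteq> 0" "2 * N + 1 \<noteq> 0"
    by (simp_all add: add.commute)
  show "N - 1 \<noteq> 0" using n by simp
qed

lemma degree_A: "degree A = 3 * n + 1"
proof -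
  have "degree (pcompose [:- (N - 1), - 2 * (N + 1), (N + 1) * (2 * N + 1):] V) = 2 * n"
    by (simp add: degree_V degree_pcompose)
  moreover have "V \<noteq> 0" "pcompose [:- (N - 1), - 2 * (N + 1), (N + 1) * (2 * N + 1):] V \<noteq> 0"
    using degree_V calculation n by auto
  ultimately show ?thesis
    unfolding A_def using n by (simp add: degree_mult_eq degree_V)
qed

lemma degree_P: "degree P = 3 * n + 1"
proof -
  have d: "degree (pcompose [:N + 1, - 1:] V) = n"
    by (simp add: degree_V degree_pcompose)
  moreover have "pcompose [:N + 1, - 1:] V \<noteq> 0"
    using d n by auto
  ultimately show ?thesis
    unfolding P_def by (simp add: degree_mult_eq degree_power_eq)
qed

lemma degree_B: "degree B \<le> 3 * n"
proof -
  have "degree (pcompose [:- 1, N + 1:] V) = n"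
    by (simp add: degree_V degree_pcompose)
  then show ?thesis
    unfolding B_def using degree_power_le[of "pcompose [:- 1, N + 1:] V" 3]
    by (simp add: numeral_poly mult.commute)
qed

lemma degree_Q: "degree Q \<le> 2 * n"
  unfolding Q_def by (simp add: degree_V degree_pcompose)

lemma poly_A: "poly A z = N * z * z ^ n * ((N + 1) * (2 * N + 1) * (z ^ n)\<^sup>2 - 2 * (N + 1) * z ^ n - (N - 1))"
  by (simp add: A_def poly_pcompose poly_V algebra_simps power2_eq_square)

lemma poly_B: "poly B z = 2 * ((N + 1) * z ^ n - 1) ^ 3"
  by (simp add: B_def poly_pcompose poly_V algebra_simps)

lemma poly_P: "poly P u = 2 * u * (N + 1 - u ^ n) ^ 3"
  by (simp add: P_def poly_pcompose poly_V algebra_simps)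

lemma poly_Q: "poly Q u = N * ((N + 1) * (2 * N + 1) - 2 * (N + 1) * u ^ n - (N - 1) * (u ^ n)\<^sup>2)"
  by (simp add: Q_def poly_pcompose poly_V algebra_simps power2_eq_square)

lemma X_pderiv_V: "x * poly (pderiv V) x = N * x ^ n"
proof -
  obtain k where k: "n = Suc k"
    using n by (cases n) auto
  have "V = [:0, 1:] ^ Suc k"
    unfolding V_def using k by simp
  then have "pderiv V = smult (of_nat (Suc k)) ([:0, 1:] ^ k)"
    by (simp only: pderiv_power_Suc) (simp add: pderiv_pCons)
  then show ?thesis
    by (simp add: k)
qed

lemma pderiv_p: "pderiv (p_poly n) = pcompose [:- 1, N + 1:] V"
proof -
  have "p_poly n = [:0, 1:] ^ Suc n - [:0, 1:]"
    by (simp add: p_poly_def algebra_simps)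
  then have *: "pderiv (p_poly n) = smult (of_nat (Suc n)) ([:0, 1:] ^ n) - 1"
    by (simp only: pderiv_diff pderiv_power_Suc) (simp add: pderiv_pCons one_pCons)
  show ?thesis
    unfolding * by (intro poly_ext_eq) (simp add: poly_pcompose poly_V algebra_simps)
qed

text \<open>
  The factor \<open>X\<close> raises the exponent \<open>n - 1\<close> to \<open>n\<close>, so that only powers of \<open>V\<close> occur.
\<close>

lemma X_pderiv2_p: "[:0, 1:] * pderiv (pderiv (p_poly n)) = smult (N * (N + 1)) V"
proof (rule poly_ext_eq)
  fix x :: complex
  have "poly ([:0, 1:] * pderiv (pderiv (p_poly n))) x = (N + 1) * (x * poly (pderiv V) x)"
    unfolding pderiv_p by (simp add: pderiv_pcompose pderiv_pCons)
  then show "poly ([:0, 1:] * pderiv (pderiv (p_poly n))) x = poly (smult (N * (N + 1)) V) x"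
    by (simp add: X_pderiv_V poly_V)
qed

lemma chebyshev_p: "chebyshev (p_poly n) = to_fract A / to_fract B"
proof -
  have "degree (pderiv (p_poly n)) = n"
    unfolding pderiv_p by (simp add: degree_V degree_pcompose)
  then have nz: "pderiv (p_poly n) \<noteq> 0"
    using n by auto
  have "p_poly n ^ 2 * pderiv (pderiv (p_poly n)) =
          [:0, 1:] * (V - 1)\<^sup>2 * ([:0, 1:] * pderiv (pderiv (p_poly n)))"
    by (simp only: p_poly_def V_def power2_eq_square mult_ac)
  then have sq: "p_poly n ^ 2 * pderiv (pderiv (p_poly n)) =
          [:0, 1:] * (V - 1)\<^sup>2 * smult (N * (N + 1)) V"
    by (simp only: X_pderiv2_p)
  have "2 * [:0, 1:] * pderiv (p_poly n) ^ 3 - 2 * p_poly n * (pderiv (p_poly n))\<^sup>2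
          - (p_poly n)\<^sup>2 * pderiv (pderiv (p_poly n)) = A"
    unfolding sq unfolding pderiv_p
  proof (rule poly_ext_eq)
    fix x :: complex
    have p: "poly (p_poly n) x = x * (x ^ n - 1)"
      by (simp add: p_poly_def)
    show "poly (2 * [:0, 1:] * pcompose [:- 1, N + 1:] V ^ 3 - 2 * p_poly n * (pcompose [:- 1, N + 1:] V)\<^sup>2
        - [:0, 1:] * (V - 1)\<^sup>2 * smult (N * (N + 1)) V) x = poly A x"
      by (simp add: poly_A poly_pcompose poly_V p) algebra
  qed
  then show ?thesis
    unfolding chebyshev_def chebyshev_L_def
    by (subst chebyshev_step_fract[OF nz]) (simp only: B_def pderiv_p)
qed

lemma coprime_PQ:
  assumes "poly Q u = 0"
  shows "poly P u \<noteq> 0"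
proof
  assume "poly P u = 0"
  then consider "u = 0" | "u ^ n = N + 1"
    by (auto simp: poly_P)
  then show False
  proof cases
    case 1
    have "poly Q 0 = N * ((N + 1) * (2 * N + 1))"
      unfolding poly_Q using n by (simp add: zero_power)
    then show False
      using assms 1 n by simp
  next
    case 2
    have "poly Q u = - (N ^ 3 * (N + 1))"
      unfolding poly_Q 2 by algebra
    then show False
      using assms n by simp
  qed
qed

lemma AB_inverse:
  assumes "u \<noteq> 0"
  shows "poly A (1 / u) = poly Q u / (u * (u ^ n) ^ 3)" "poly B (1 / u) = poly P u / (u * (u ^ n) ^ 3)"
proof -
  have v: "u ^ n \<noteq> 0"
    using assms by simp
  show "poly A (1 / u) = poly Q u / (u * (u ^ n) ^ 3)" "poly B (1 / u) = poly P u / (u * (u ^ n) ^ 3)"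
    unfolding poly_A poly_B poly_P poly_Q power_one_over[symmetric] 
    using assms v by (simp_all add: field_simps power_divide power2_eq_square power3_eq_cube)
qed

lemma coprime_AB:
  assumes "poly B z = 0"
  shows "poly A z \<noteq> 0"
proof (cases "z = 0")
  case True
  then show ?thesis
    using assms n by (simp add: poly_B power_0_left)
next
  case False
  then show ?thesis
    using assms AB_inverse[of "1 / z"] coprime_PQ[of "1 / z"] by auto
qed

lemma R_eq:
  "R (Fin z) = (if poly B z = 0 then Infty else Fin (poly A z / poly B z))" "R Infty = Infty"
proof -
  have "poly B 0 = - 2"
    using n by (simp add: poly_B power_0_left)
  then have "B \<noteq> 0" by auto
  then show "R (Fin z) = (if poly B z = 0 then Infty else Fin (poly A z / poly B z))" "R Infty = Infty"
    unfolding R_def chebyshev_p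
    using sphere_map_quotient[of B A] coprime_AB degree_A degree_B by auto
qed

definition \<rho> :: real where "\<rho> = 8 * real n * (real n + 1)"

lemma R_chart: "R (chart u) = (if poly Q u = 0 then Fin 0 else chart (poly P u / poly Q u))"
proof (cases "u = 0")
  case True
  have "poly P 0 = 0"
    by (simp add: poly_P)
  then show ?thesis
    using True coprime_PQ[of 0] R_eq(2) by (auto simp: chart_def)
next
  case False
  have d: "u * (u ^ n) ^ 3 \<noteq> 0"
    using False by simp
  show ?thesis
    using False d coprime_PQ[of u] by (auto simp: R_eq AB_inverse chart_def)
qed

text \<open>
  For \<open>t = cmod (u ^ n) \<ge> \<rho>\<close> the leading terms dominate: the numerator is at least \<open>cmod u * t ^ 3 / 4\<close>, the
  denominator at most \<open>n\<^sup>2 * t\<^sup>2\<close>, and \<open>t \<ge> 8 * n\<^sup>2\<close>.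
\<close>

lemma outside:
  assumes "cmod u \<ge> \<rho>"
  shows "poly Q u \<noteq> 0" "cmod (poly P u / poly Q u) \<ge> 2 * cmod u"
proof -
  define x where "x = real n"
  define t where "t = cmod (u ^ n)"
  have x: "x \<ge> 2"
    using n by (simp add: x_def)
  have "1 \<le> 8 * x * (x + 1)"
    using mult_mono[of 16 "8 * x" 3 "x + 1"] x by simp
  then have u1: "cmod u \<ge> 1"
    using assms by (simp add: \<rho>_def x_def)
  have "cmod u ^ 1 \<le> cmod u ^ n"
    using u1 n by (intro power_increasing) auto
  then have t: "t \<ge> 8 * x * (x + 1)"
    using assms by (simp add: t_def norm_power \<rho>_def x_def)
  have "16 * (x + 1) \<le> 8 * x * (x + 1)"
    using x by (intro mult_right_mono) auto
  then have t16: "t \<ge> 16 * (x + 1)"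
    using t by simp
  then have t0: "t > 0"
    using x by simp
  have NR: "N = of_real x"
    by (simp add: x_def)
  have e1: "16 * ((x + 1) * t) \<le> t * t"
    using mult_right_mono[OF t16, of t] t0 by (simp add: mult.assoc)
  have e2: "16 * ((x + 1) * (x + 1)) \<le> (x + 1) * t"
    using mult_left_mono[OF t16, of "x + 1"] x by (simp add: mult_ac)
  have e3: "(x + 1) * (2 * x + 1) \<le> 2 * ((x + 1) * (x + 1))"
    using x by (simp add: algebra_simps)
  have small: "cmod (complex_of_real ((x + 1) * (2 * x + 1)) - complex_of_real (2 * (x + 1)) * u ^ n)
      \<le> (x + 1) * (2 * x + 1) + 2 * ((x + 1) * t)"
    unfolding mult.assoc[of 2 "x + 1" t, symmetric]
    using norm_triangle_ineq4[of "complex_of_real ((x + 1) * (2 * x + 1))" "complex_of_real (2 * (x + 1)) * u ^ n"] x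
    by (simp only: norm_mult norm_of_real t_def) simp
  have small': "(x + 1) * (2 * x + 1) + 2 * ((x + 1) * t) \<le> t * t / 4"
    using e1 e2 e3 zero_le_square[of t] by linarith
  have Q: "poly Q u = of_real x * ((complex_of_real ((x + 1) * (2 * x + 1)) - complex_of_real (2 * (x + 1)) * u ^ n)
      - of_real (x - 1) * (u ^ n)\<^sup>2)"
    unfolding poly_Q NR by simp
  have nq: "cmod (of_real (x - 1) * (u ^ n)\<^sup>2) = (x - 1) * (t * t)"
    using x by (simp only: norm_mult norm_power norm_of_real t_def) (simp add: power2_eq_square)
  have "t * t \<le> (x - 1) * (t * t)"
    using x mult_right_mono[of 1 "x - 1" "t * t"] t0 by simp
  then have "cmod (complex_of_real ((x + 1) * (2 * x + 1)) - complex_of_real (2 * (x + 1)) * u ^ n)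
      < cmod (of_real (x - 1) * (u ^ n)\<^sup>2)"
    using small small' nq t0 mult_pos_pos[OF t0 t0] by linarith
  then show Q0: "poly Q u \<noteq> 0"
    using x by (auto simp: Q)
  have "cmod (poly Q u) = x * cmod ((complex_of_real ((x + 1) * (2 * x + 1)) - complex_of_real (2 * (x + 1)) * u ^ n)
      - of_real (x - 1) * (u ^ n)\<^sup>2)"
    unfolding Q norm_mult[of "of_real x"] norm_of_real using x by simp
  also have "\<dots> \<le> x * (t * t / 4 + (x - 1) * (t * t))"
    using norm_triangle_ineq4[of "complex_of_real ((x + 1) * (2 * x + 1)) - complex_of_real (2 * (x + 1)) * u ^ n"
        "of_real (x - 1) * (u ^ n)\<^sup>2"] small small' nq x
    by (intro mult_left_mono) linarith+
  also have "\<dots> \<le> x * (x * (t * t))"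
    using x t0 by (intro mult_left_mono) (auto simp: algebra_simps)
  finally have Qle: "cmod (poly Q u) \<le> x * x * (t * t)"
    by (simp add: mult_ac)
  have "t - (x + 1) \<le> cmod (u ^ n - of_real (x + 1))"
    using norm_triangle_ineq2[of "u ^ n" "of_real (x + 1)"] x unfolding t_def norm_of_real by simp
  also have "\<dots> = cmod (N + 1 - u ^ n)"
    unfolding NR by (subst norm_minus_commute) simp
  finally have half: "t / 2 \<le> cmod (N + 1 - u ^ n)"
    using t16 x by simp
  have "2 * cmod u * (t / 2) ^ 3 \<le> cmod (poly P u)"
    unfolding poly_P norm_mult norm_power using half t0 by (intro mult_mono power_mono) auto
  moreover have "2 * cmod u * (x * x * (t * t)) \<le> 2 * cmod u * (t / 2) ^ 3"
  proof (rule mult_left_mono)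
    have "x * x * 8 \<le> t"
      using t x by (simp add: algebra_simps)
    then have "(x * x * 8) * (t * t) \<le> t * (t * t)"
      by (intro mult_right_mono) auto
    then show "x * x * (t * t) \<le> (t / 2) ^ 3"
      by (simp add: power3_eq_cube)
  qed simp
  moreover have "2 * cmod u * cmod (poly Q u) \<le> 2 * cmod u * (x * x * (t * t))"
    using Qle by (intro mult_left_mono) auto
  ultimately have "2 * cmod u * cmod (poly Q u) \<le> cmod (poly P u)"
    by linarith
  then show "cmod (poly P u / poly Q u) \<ge> 2 * cmod u"
    using Q0 by (simp add: norm_divide field_simps)
qed

sublocale attracting_origin_map R P Q \<rho>
proof
  show "R (Fin 0) = Fin 0"
    using n by (simp add: R_eq poly_A poly_B power_0_left)
  show "degree Q < degree P"
    using degree_P degree_Q by simp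
  show "\<rho> > 0"
    using n by (simp add: \<rho>_def)
qed (use R_chart coprime_PQ outside in auto)

text \<open>
  The factorization exhibits the critical points: the preimages \<open>u ^ n = n + 1\<close> of \<open>0\<close>, the roots of unity,
  and the free critical points \<open>u ^ n = - (n + 1) * (2 * n + 1) / (n - 1)\<close>.
\<close>

lemma poly_wronskian:
  "poly wronskian u = 2 * N * (N + 1) * (N + 1 - u ^ n)\<^sup>2 * (1 - u ^ n)\<^sup>2 * ((N + 1) * (2 * N + 1) + (N - 1) * u ^ n)"
proof -
  have dP: "poly (pderiv P) u = 2 * (N + 1 - u ^ n) ^ 3 - 6 * (N + 1 - u ^ n)\<^sup>2 * (u * poly (pderiv V) u)"
    by (simp add: P_def pderiv_mult pderiv_smult pderiv_pcompose pderiv_power pderiv_pCons poly_pcompose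
        poly_V algebra_simps)
  have dQ: "u * poly (pderiv Q) u = N * (- 2 * (N + 1) - 2 * (N - 1) * u ^ n) * (u * poly (pderiv V) u)"
    by (simp add: Q_def pderiv_mult pderiv_smult pderiv_pcompose pderiv_pCons poly_pcompose poly_V algebra_simps)
  have "poly wronskian u = poly (pderiv P) u * poly Q u - 2 * (N + 1 - u ^ n) ^ 3 * (u * poly (pderiv Q) u)"
    by (simp add: wronskian_def poly_P)
  also have "\<dots> = 2 * N * (N + 1) * (N + 1 - u ^ n)\<^sup>2 * (1 - u ^ n)\<^sup>2 * ((N + 1) * (2 * N + 1) + (N - 1) * u ^ n)"
    unfolding dP dQ X_pderiv_V poly_Q by algebra
  finally show ?thesis .
qed

end

section \<open>Orbits of the free critical points\<close>

text \<open>
  The inequality of the arithmetic and geometric means for \<open>c\<close>, \<open>y / 2\<close> and \<open>y / 2\<close>.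
\<close>

lemma four_cube_ge:
  fixes c y :: real
  assumes "c \<ge> 0" "y \<ge> 0"
  shows "27 * c * y\<^sup>2 \<le> 4 * (c + y) ^ 3"
proof -
  have "4 * (c + y) ^ 3 - 27 * c * y\<^sup>2 = (y - 2 * c)\<^sup>2 * (4 * y + c)"
    by (simp add: algebra_simps power2_eq_square power3_eq_cube)
  moreover have "0 \<le> (y - 2 * c)\<^sup>2 * (4 * y + c)"
    using assms by simp
  ultimately show ?thesis
    by linarith
qed

context chebyshev_unity
begin

abbreviation x\<^sub>n :: real where "x\<^sub>n \<equiv> real n"

text \<open>
  If \<open>v = u ^ n\<close> is real, then \<open>f\<close> multiplies \<open>u\<close> by the real number \<open>scale v\<close>. The dynamics on such points
  therefore reduces to \<open>v \<mapsto> v * scale v ^ n\<close> on the real line. Where \<open>den\<close> is positive, the sign of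
  \<open>(1 - v) * cofactor v\<close> tells whether \<open>scale v\<close> is larger or smaller than \<open>1\<close>.
\<close>

definition den :: "real \<Rightarrow> real" where
  "den v = (x\<^sub>n + 1) * (2 * x\<^sub>n + 1) - 2 * (x\<^sub>n + 1) * v - (x\<^sub>n - 1) * v\<^sup>2"

definition scale :: "real \<Rightarrow> real" where
  "scale v = 2 * (x\<^sub>n + 1 - v) ^ 3 / (x\<^sub>n * den v)"

definition cofactor :: "real \<Rightarrow> real" where
  "cofactor v = 2 * v\<^sup>2 - (x\<^sub>n + 1) * (x\<^sub>n + 4) * v + (x\<^sub>n + 1) * (3 * x\<^sub>n + 2)"

lemma n_real_ge_2: "x\<^sub>n \<ge> 2"
  using n by simp

lemma numerator_minus_denominator: "2 * (x\<^sub>n + 1 - v) ^ 3 - x\<^sub>n * den v = (1 - v) * cofactor v"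
  unfolding den_def cofactor_def by algebra

lemma f_on_ray:
  assumes u: "u ^ n = of_real v" and den: "den v \<noteq> 0"
  shows "poly Q u \<noteq> 0" "f u = u * of_real (scale v)" "f u ^ n = of_real (v * scale v ^ n)"
    "R (chart u) = chart (f u)"
proof -
  have Q: "poly Q u = of_real (x\<^sub>n * den v)"
    by (simp add: poly_Q u den_def)
  then show Q0: "poly Q u \<noteq> 0"
    using den n_real_ge_2 by simp
  have "poly P u = u * of_real (2 * (x\<^sub>n + 1 - v) ^ 3)"
    by (simp add: poly_P u)
  then show fu: "f u = u * of_real (scale v)"
    using f_regular[OF Q0] by (simp add: Q scale_def)
  show "f u ^ n = of_real (v * scale v ^ n)"
    by (simp add: fu power_mult_distrib u)
  show "R (chart u) = chart (f u)"
    by (rule R_chart_regular[OF Q0])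
qed

lemma expanding_ray_in_basin:
  assumes X: "\<And>v. v \<in> X \<Longrightarrow> den v \<noteq> 0" "\<And>v. v \<in> X \<Longrightarrow> \<bar>scale v\<bar> \<ge> c" "\<And>v. v \<in> X \<Longrightarrow> v * scale v ^ n \<in> X"
    and c: "c > 1" and "0 \<notin> X" and u: "u ^ n = of_real v" "v \<in> X"
  shows "chart u \<in> basin R (Fin 0)"
proof -
  have iter: "(R ^^ m) (chart u) = chart ((f ^^ m) u) \<and> cmod ((f ^^ m) u) \<ge> c ^ m * cmod u \<and>
      (\<exists>w\<in>X. (f ^^ m) u ^ n = of_real w)" for m
  proof (induction m)
    case 0
    then show ?case using u by auto
  next
    case (Suc m)
    then obtain w where w: "w \<in> X" "(f ^^ m) u ^ n = of_real w" by blast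
    note step = f_on_ray[OF w(2) X(1)[OF w(1)]]
    have "c * (c ^ m * cmod u) \<le> \<bar>scale w\<bar> * cmod ((f ^^ m) u)"
      using Suc X(2)[OF w(1)] c by (intro mult_mono) auto
    then have "cmod ((f ^^ Suc m) u) \<ge> c ^ Suc m * cmod u"
      using step(2) by (simp add: norm_mult mult_ac)
    moreover have "\<exists>w\<in>X. (f ^^ Suc m) u ^ n = of_real w"
      using step(3) X(3)[OF w(1)] by (metis funpow.simps(2) o_apply)
    ultimately show ?case
      using Suc step(4) by simp
  qed
  have "u \<noteq> 0"
  proof
    assume "u = 0"
    then have "of_real v = (0 :: complex)"
      using u(1) n by (simp add: zero_power)
    then show False
      using u(2) \<open>0 \<notin> X\<close> by simp
  qed
  obtain m where "\<rho> / cmod u < c ^ m"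
    using real_arch_pow[OF c] by blast
  then have "\<rho> < c ^ m * cmod u"
    using \<open>u \<noteq> 0\<close> by (simp add: field_simps)
  then have "cmod ((f ^^ m) u) \<ge> \<rho>"
    using iter[of m] by linarith
  then have "(R ^^ m) (chart u) \<in> basin R (Fin 0)"
    using outside_in_basin iter[of m] by metis
  then show ?thesis
    by (simp add: basin_iterate_iff)
qed

text \<open>
  The action of \<open>f\<close> on the rays from \<open>0\<close> through the roots of unity.
\<close>

definition radial :: "real \<Rightarrow> real" where
  "radial t = t * scale (t ^ n)"

text \<open>
  The real counterpart of \<open>poly_wronskian\<close>; it is nonnegative for \<open>t > 0\<close>, so \<open>radial\<close> is monotone
  between its poles.
\<close>

lemma radial_derivative:
  assumes "den (t ^ n) \<noteq> 0"
  shows "(radial has_real_derivative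
           2 * x\<^sub>n * (x\<^sub>n + 1) * (x\<^sub>n + 1 - t ^ n)\<^sup>2 * (1 - t ^ n)\<^sup>2 * ((x\<^sub>n + 1) * (2 * x\<^sub>n + 1) + (x\<^sub>n - 1) * t ^ n)
             / (x\<^sub>n * den (t ^ n))\<^sup>2) (at t)"
proof -
  have radial: "radial = (\<lambda>t. 2 * t * (x\<^sub>n + 1 - t ^ n) ^ 3 / (x\<^sub>n * den (t ^ n)))"
    by (simp add: radial_def scale_def fun_eq_iff)
  obtain k where k: "n = Suc k"
    using n by (cases n) auto
  define p where "p = t ^ k"
  have tp: "t * p = t ^ n"
    by (simp add: p_def k)
  have dt: "((\<lambda>t. t ^ n) has_real_derivative x\<^sub>n * p) (at t)"
    using DERIV_pow[of n t] by (simp add: p_def k)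
  have dq: "((\<lambda>t. den (t ^ n)) has_real_derivative (- 2 * (x\<^sub>n + 1) - 2 * (x\<^sub>n - 1) * t ^ n) * (x\<^sub>n * p)) (at t)"
    unfolding den_def by (rule derivative_eq_intros dt refl)+ (simp add: algebra_simps)
  have da: "((\<lambda>t. 2 * t * (x\<^sub>n + 1 - t ^ n) ^ 3) has_real_derivative
      2 * (x\<^sub>n + 1 - t ^ n) ^ 3 - 6 * t * (x\<^sub>n + 1 - t ^ n)\<^sup>2 * (x\<^sub>n * p)) (at t)"
    by (rule derivative_eq_intros dt refl)+ (simp add: algebra_simps)
  have nz: "x\<^sub>n * den (t ^ n) \<noteq> 0"
    using assms n_real_ge_2 by simp
  have D: "(radial has_real_derivative
      ((2 * (x\<^sub>n + 1 - t ^ n) ^ 3 - 6 * t * (x\<^sub>n + 1 - t ^ n)\<^sup>2 * (x\<^sub>n * p)) * (x\<^sub>n * den (t ^ n))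
        - 2 * t * (x\<^sub>n + 1 - t ^ n) ^ 3 * (x\<^sub>n * ((- 2 * (x\<^sub>n + 1) - 2 * (x\<^sub>n - 1) * t ^ n) * (x\<^sub>n * p))))
      / ((x\<^sub>n * den (t ^ n)) * (x\<^sub>n * den (t ^ n)))) (at t)"
    unfolding radial by (rule DERIV_divide[OF da DERIV_cmult[OF dq] nz])
  have "(2 * (x\<^sub>n + 1 - t ^ n) ^ 3 - 6 * t * (x\<^sub>n + 1 - t ^ n)\<^sup>2 * (x\<^sub>n * p)) * (x\<^sub>n * den (t ^ n))
        - 2 * t * (x\<^sub>n + 1 - t ^ n) ^ 3 * (x\<^sub>n * ((- 2 * (x\<^sub>n + 1) - 2 * (x\<^sub>n - 1) * t ^ n) * (x\<^sub>n * p)))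
      = 2 * x\<^sub>n * (x\<^sub>n + 1) * (x\<^sub>n + 1 - t ^ n)\<^sup>2 * (1 - t ^ n)\<^sup>2 * ((x\<^sub>n + 1) * (2 * x\<^sub>n + 1) + (x\<^sub>n - 1) * t ^ n)"
    unfolding den_def tp[symmetric] by algebra
  with D show ?thesis
    by (simp add: power2_eq_square)
qed

text \<open>
  By monotonicity \<open>t\<close> stays on its side of the fixed point \<open>1\<close>, and the sign of \<open>(1 - t ^ n) * cofactor (t ^ n)\<close>
  shows that it moves towards \<open>1\<close>.
\<close>

lemma radial_between:
  assumes b: "b \<ge> 1" "\<And>v. 0 < v \<Longrightarrow> v \<le> b \<Longrightarrow> den v > 0 \<and> cofactor v > 0"
    and t: "0 < t" "t ^ n \<le> b"
  shows "t \<le> 1 \<Longrightarrow> t \<le> radial t \<and> radial t \<le> 1" "1 \<le> t \<Longrightarrow> 1 \<le> radial t \<and> radial t \<le> t"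
proof -
  have S1: "scale 1 = 1"
    using numerator_minus_denominator[of 1] b(2)[of 1] b(1) n_real_ge_2 by (simp add: scale_def)
  have mono: "radial r \<le> radial s" if "0 < r" "r \<le> s" "s ^ n \<le> b" for r s
  proof (rule DERIV_nonneg_imp_nondecreasing[OF that(2)])
    fix w assume w: "r \<le> w" "w \<le> s"
    have "w ^ n \<le> s ^ n"
      using w that by (intro power_mono) auto
    then have "den (w ^ n) > 0" "w ^ n > 0"
      using b(2)[of "w ^ n"] w that by auto
    then show "\<exists>y. (radial has_real_derivative y) (at w) \<and> 0 \<le> y"
      using radial_derivative[of w] n_real_ge_2
      by (intro exI conjI) (auto intro!: divide_nonneg_nonneg mult_nonneg_nonneg add_nonneg_nonneg)
  qed
  have den: "den (t ^ n) > 0" "cofactor (t ^ n) > 0" "x\<^sub>n * den (t ^ n) > 0"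
    using b(2)[of "t ^ n"] t n_real_ge_2 by auto
  {
    assume "t \<le> 1"
    then have "t ^ n \<le> 1"
      using t(1) by (simp add: power_le_one)
    then have "0 \<le> (1 - t ^ n) * cofactor (t ^ n)"
      using den by simp
    then have "1 \<le> scale (t ^ n)"
      using numerator_minus_denominator[of "t ^ n"] den by (simp add: scale_def)
    then show "t \<le> radial t \<and> radial t \<le> 1"
      using mono[of t 1] \<open>t \<le> 1\<close> t(1) b(1) S1 by (simp add: radial_def)
  next
    assume "1 \<le> t"
    then have "1 \<le> t ^ n"
      by simp
    then have "(1 - t ^ n) * cofactor (t ^ n) \<le> 0"
      using den by (simp add: mult_nonpos_nonneg)
    then have "scale (t ^ n) \<le> 1"
      using numerator_minus_denominator[of "t ^ n"] den by (simp add: scale_def)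
    then show "1 \<le> radial t \<and> radial t \<le> t"
      using mono[of 1 t] \<open>1 \<le> t\<close> t S1 mult_left_mono[of "scale (t ^ n)" 1 t] by (simp add: radial_def)
  }
qed

text \<open>
  The orbit is monotone and bounded, and its limit can only be the fixed point \<open>1\<close>.
\<close>

lemma radial_iterates_tendsto_1:
  assumes b: "b \<ge> 1" "\<And>v. 0 < v \<Longrightarrow> v \<le> b \<Longrightarrow> den v > 0 \<and> cofactor v > 0"
    and t: "0 < t" "t ^ n \<le> b"
  shows "(\<lambda>m. (radial ^^ m) t) \<longlonglongrightarrow> 1"
proof -
  note gb = radial_between[OF b]
  have limit: "L = 1" if L: "(\<lambda>m. (radial ^^ m) t) \<longlonglongrightarrow> L" "0 < L" "L ^ n \<le> b" for L
  proof -
    have den: "den (L ^ n) > 0" "cofactor (L ^ n) > 0"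
      using b(2)[of "L ^ n"] L by auto
    have "isCont radial L"
      using radial_derivative[of L] den(1) DERIV_isCont by force
    then have "(\<lambda>m. radial ((radial ^^ m) t)) \<longlonglongrightarrow> radial L"
      using L(1) by (rule isCont_tendsto_compose)
    moreover have "(\<lambda>m. radial ((radial ^^ m) t)) \<longlonglongrightarrow> L"
      using LIMSEQ_Suc[OF L(1)] by simp
    ultimately have "radial L = L"
      by (rule LIMSEQ_unique)
    then have "scale (L ^ n) = 1"
      using L(2) by (simp add: radial_def)
    then have "(1 - L ^ n) * cofactor (L ^ n) = 0"
      using numerator_minus_denominator[of "L ^ n"] den n_real_ge_2 by (simp add: scale_def field_simps)
    then have "L ^ n = 1"
      using den by simp
    then show "L = 1"
      using power_eq_imp_eq_base[of L n 1] L(2) n by simp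
  qed
  show ?thesis
  proof (cases "t \<le> 1")
    case True
    have inv: "t \<le> (radial ^^ m) t \<and> (radial ^^ m) t \<le> 1" for m
    proof (induction m)
      case (Suc m)
      then have "(radial ^^ m) t ^ n \<le> 1" "0 < (radial ^^ m) t"
        using t by (auto simp: power_le_one)
      then show ?case
        using gb(1)[of "(radial ^^ m) t"] Suc b(1) by simp
    qed (use True in simp)
    have "incseq (\<lambda>m. (radial ^^ m) t)"
    proof (rule incseq_SucI)
      fix m
      have "(radial ^^ m) t ^ n \<le> 1" "0 < (radial ^^ m) t"
        using inv[of m] t by (auto simp: power_le_one)
      then show "(radial ^^ m) t \<le> (radial ^^ Suc m) t"
        using gb(1)[of "(radial ^^ m) t"] inv[of m] b(1) by simp
    qed
    then obtain L where L: "(\<lambda>m. (radial ^^ m) t) \<longlonglongrightarrow> L" "\<And>m. (radial ^^ m) t \<le> L"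
      using incseq_convergent[of "\<lambda>m. (radial ^^ m) t" 1] inv by blast
    have "L \<le> 1"
      using L(1) inv by (intro LIMSEQ_le_const2) auto
    moreover have "0 < L"
      using L(2)[of 0] t(1) by simp
    ultimately have "L = 1"
      using limit[OF L(1)] b(1) power_le_one[of L n] by simp
    then show ?thesis
      using L(1) by simp
  next
    case False
    have inv: "1 \<le> (radial ^^ m) t \<and> (radial ^^ m) t \<le> t" for m
    proof (induction m)
      case (Suc m)
      then have "(radial ^^ m) t ^ n \<le> t ^ n" "0 < (radial ^^ m) t"
        by (auto intro: power_mono)
      then show ?case
        using gb(2)[of "(radial ^^ m) t"] Suc t by simp
    qed (use False in simp)
    have "decseq (\<lambda>m. (radial ^^ m) t)"
    proof (rule decseq_SucI)
      fix m
      have "(radial ^^ m) t ^ n \<le> t ^ n" "0 < (radial ^^ m) t"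
        using inv[of m] by (auto intro: power_mono)
      then show "(radial ^^ Suc m) t \<le> (radial ^^ m) t"
        using gb(2)[of "(radial ^^ m) t"] inv[of m] t by simp
    qed
    then obtain L where L: "(\<lambda>m. (radial ^^ m) t) \<longlonglongrightarrow> L" "\<And>m. L \<le> (radial ^^ m) t"
      using decseq_convergent[of "\<lambda>m. (radial ^^ m) t" 1] inv by blast
    have "1 \<le> L"
      using L(1) inv by (intro LIMSEQ_le_const) auto
    moreover have "L ^ n \<le> t ^ n"
      using L(2)[of 0] \<open>1 \<le> L\<close> by (intro power_mono) auto
    ultimately have "L = 1"
      using limit[OF L(1)] t by simp
    then show ?thesis
      using L(1) by simp
  qed
qed

lemma positive_ray_in_basin:
  assumes b: "b \<ge> 1" "\<And>v. 0 < v \<Longrightarrow> v \<le> b \<Longrightarrow> den v > 0 \<and> cofactor v > 0"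
    and u: "u ^ n = of_real v" "0 < v" "v \<le> b"
  shows "\<exists>\<zeta>. \<zeta> ^ n = 1 \<and> chart u \<in> basin R (chart \<zeta>)"
proof -
  define t where "t = cmod u"
  define \<zeta> where "\<zeta> = u / of_real t"
  have tn: "t ^ n = v"
    using arg_cong[OF u(1), of cmod] u(2) by (simp add: t_def norm_power)
  have t0: "t > 0"
    using tn u(2) n by (cases "t = 0") (auto simp: t_def zero_power)
  have \<zeta>: "\<zeta> ^ n = 1" "u = \<zeta> * of_real t"
    using t0 u by (simp_all add: \<zeta>_def power_divide tn flip: of_real_power)
  have iter: "(R ^^ m) (chart u) = chart (\<zeta> * of_real ((radial ^^ m) t)) \<and> 0 < (radial ^^ m) t \<and> (radial ^^ m) t ^ n \<le> b" for m
  proof (induction m)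
    case 0
    then show ?case
      using \<zeta> t0 tn u by simp
  next
    case (Suc m)
    define s where "s = (radial ^^ m) t"
    have s: "0 < s" "s ^ n \<le> b"
      using Suc by (simp_all add: s_def)
    have "(\<zeta> * of_real s) ^ n = of_real (s ^ n)"
      by (simp add: power_mult_distrib \<zeta>(1))
    moreover have "den (s ^ n) \<noteq> 0"
      using b(2)[of "s ^ n"] s by auto
    ultimately have "R (chart (\<zeta> * of_real s)) = chart (\<zeta> * of_real (radial s))"
      using f_on_ray(2,4)[of "\<zeta> * of_real s" "s ^ n"] by (simp add: radial_def mult.assoc)
    moreover have "0 < radial s \<and> radial s ^ n \<le> b"
    proof (cases "s \<le> 1")
      case True
      then show ?thesis
        using radial_between(1)[OF b s] s b(1) power_le_one[of "radial s" n] by auto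
    next
      case False
      then show ?thesis
        using radial_between(2)[OF b s] s power_mono[of "radial s" s n] by auto
    qed
    ultimately show ?case
      using Suc by (simp add: s_def)
  qed
  have "(\<lambda>m. \<zeta> * of_real ((radial ^^ m) t)) \<longlonglongrightarrow> \<zeta> * of_real 1"
    using radial_iterates_tendsto_1[OF b t0] tn u(3) by (intro tendsto_intros) auto
  then have "(\<lambda>m. chart (\<zeta> * of_real ((radial ^^ m) t))) \<longlonglongrightarrow> chart \<zeta>"
    by (simp add: tendsto_chart_iff)
  then show ?thesis
    using iter \<zeta>(1) by (auto simp: basin_def)
qed

text \<open>
  The free critical points are the solutions of \<open>u ^ n = - crit\<close>, and \<open>f\<close> multiplies them by \<open>- crit_scale\<close>.
\<close>

definition crit :: real where "crit = (x\<^sub>n + 1) * (2 * x\<^sub>n + 1) / (x\<^sub>n - 1)"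

definition crit_scale :: real where "crit_scale = 27 * (x\<^sub>n + 1)\<^sup>2 / ((x\<^sub>n - 1)\<^sup>2 * (2 * x\<^sub>n + 1))"

lemma critical_value_factor: "den (- crit) < 0" "scale (- crit) = - crit_scale" "crit > 0" "crit_scale > 0"
proof -
  define k where "k = (x\<^sub>n + 1) * (2 * x\<^sub>n + 1)"
  define d where "d = x\<^sub>n - 1"
  have pos: "d > 0" "k > 0" "x\<^sub>n > 0" "x\<^sub>n + 1 > 0" "2 * x\<^sub>n + 1 > 0"
    using n_real_ge_2 by (simp_all add: k_def d_def)
  have yk: "crit * d = k"
    using pos by (simp add: crit_def k_def d_def)
  have "den (- crit) * d = k * d + 2 * (x\<^sub>n + 1) * (crit * d) - (crit * d) * (crit * d)"
    by (simp add: den_def k_def d_def) algebra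
  also have "\<dots> = - 2 * x\<^sub>n\<^sup>2 * k"
    unfolding yk by (simp add: k_def d_def) algebra
  finally have den: "den (- crit) = - 2 * x\<^sub>n\<^sup>2 * k / d"
    using pos by (simp add: field_simps)
  then show "den (- crit) < 0"
    using pos by simp
  have "(x\<^sub>n + 1 - (- crit)) * d = 3 * x\<^sub>n * (x\<^sub>n + 1)"
    using yk by (simp add: k_def d_def algebra_simps)
  then have num: "x\<^sub>n + 1 - (- crit) = 3 * x\<^sub>n * (x\<^sub>n + 1) / d"
    using pos by (simp add: field_simps)
  have "2 * (3 * x * a / d) ^ 3 / (x * (- 2 * x\<^sup>2 * (a * e) / d)) = - (27 * a\<^sup>2 / (d\<^sup>2 * e))"
    if "x \<noteq> 0" "a \<noteq> 0" "e \<noteq> 0" for x a e :: real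
    using that pos by (simp add: field_simps power2_eq_square power3_eq_cube)
  then show "scale (- crit) = - crit_scale"
    unfolding scale_def num den crit_scale_def d_def[symmetric] k_def using pos by simp
  show "crit > 0" "crit_scale > 0"
    using pos n_real_ge_2 by (simp_all add: crit_def crit_scale_def d_def)
qed

text \<open>
  For even \<open>n\<close> the rays through the free critical points are mapped to such rays, and \<open>\<bar>scale\<bar>\<close> stays
  above \<open>101/100\<close> beyond the critical points. For \<open>n \<le> 15\<close> this follows from \<open>four_cube_ge\<close>. For \<open>n = 16\<close> the
  margin is too small for that estimate; there the cubic in question is compared with one that has a double
  root at \<open>40\<close>, close to the place where \<open>\<bar>scale\<bar>\<close> is least.
\<close>

lemma critical_even:
  assumes u: "u ^ n = of_real (- crit)" and even: "even n" and small: "n \<le> 16"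
  shows "chart u \<in> basin R (Fin 0)"
proof -
  have neg: "den (- w) < 0" if w: "w \<ge> crit" for w
  proof -
    define k where "k = (x\<^sub>n + 1) * (2 * x\<^sub>n + 1)"
    have w0: "w > 0"
      using w critical_value_factor(3) by simp
    have "den (- crit) / crit < 0"
      using critical_value_factor(1,3) by (intro divide_neg_pos)
    moreover have "den (- crit) / crit = k / crit + 2 * (x\<^sub>n + 1) - (x\<^sub>n - 1) * crit"
      using critical_value_factor(3) by (simp add: den_def k_def field_simps power2_eq_square)
    moreover have "den (- w) / w = k / w + 2 * (x\<^sub>n + 1) - (x\<^sub>n - 1) * w"
      using w0 by (simp add: den_def k_def field_simps power2_eq_square)
    moreover have "k / w \<le> k / crit"
      using w critical_value_factor(3) n_real_ge_2 by (intro divide_left_mono) (auto simp: k_def w0)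
    moreover have "(x\<^sub>n - 1) * crit \<le> (x\<^sub>n - 1) * w"
      using w n_real_ge_2 by (intro mult_left_mono) auto
    ultimately have "den (- w) / w < 0"
      by linarith
    then show ?thesis
      using w0 by (simp add: divide_less_0_iff)
  qed
  have large: "\<bar>scale (- w)\<bar> \<ge> 101/100" if w: "w \<ge> crit" for w
  proof -
    have w0: "w > 0"
      using w critical_value_factor(3) by simp
    have key: "101/100 * (x\<^sub>n * - den (- w)) \<le> 2 * (x\<^sub>n + 1 + w) ^ 3"
    proof (cases "n = 16")
      case False
      then have "n \<le> 15" using small by simp
      then have x15: "x\<^sub>n \<le> 15" by simp
      have "0 \<le> (x\<^sub>n + 1) * (2 * x\<^sub>n + 1) + 2 * (x\<^sub>n + 1) * w"
        using w0 n_real_ge_2 by (intro add_nonneg_nonneg mult_nonneg_nonneg) auto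
      then have "- den (- w) \<le> (x\<^sub>n - 1) * w\<^sup>2"
        by (simp add: den_def)
      then have "101/100 * (x\<^sub>n * - den (- w)) \<le> 101/100 * (x\<^sub>n * ((x\<^sub>n - 1) * w\<^sup>2))"
        using n_real_ge_2 by (intro mult_left_mono) auto
      also have "\<dots> = (101/100 * (x\<^sub>n * (x\<^sub>n - 1))) * w\<^sup>2"
        by simp
      also have "\<dots> \<le> (27/2 * (x\<^sub>n + 1)) * w\<^sup>2"
      proof (rule mult_right_mono)
        have "101/100 * (x\<^sub>n * (x\<^sub>n - 1)) \<le> 101/100 * (x\<^sub>n * 14)"
          using x15 by (intro mult_left_mono) auto
        also have "\<dots> \<le> 27/2 * (x\<^sub>n + 1)"
          using x15 by simp
        finally show "101/100 * (x\<^sub>n * (x\<^sub>n - 1)) \<le> 27/2 * (x\<^sub>n + 1)" .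
      qed simp
      also have "\<dots> \<le> 2 * (x\<^sub>n + 1 + w) ^ 3"
        using four_cube_ge[of "x\<^sub>n + 1" w] w0 by simp
      finally show ?thesis .
    next
      case True
      then have x: "x\<^sub>n = 16" by simp
      have "w > 30"
        using w by (simp add: crit_def x)
      then have "0 \<le> (w - 40)\<^sup>2 * (2 * w + 19) + 3/5 * w\<^sup>2 + (15086/25 * w - 287706/25)"
        by (intro add_nonneg_nonneg mult_nonneg_nonneg) auto
      also have "\<dots> = 2 * (16 + 1 + w) ^ 3 - 101/100 * (16 * - den (- w))"
        by (simp add: den_def x algebra_simps power2_eq_square power3_eq_cube)
      finally show ?thesis
        by (simp add: x)
    qed
    have "scale (- w) = - (2 * (x\<^sub>n + 1 + w) ^ 3 / (x\<^sub>n * - den (- w)))"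
      by (simp add: scale_def)
    moreover have "x\<^sub>n * - den (- w) > 0"
      using neg[OF w] n_real_ge_2 by (intro mult_pos_pos) auto
    from pos_le_divide_eq[OF this] key
    have "101/100 \<le> 2 * (x\<^sub>n + 1 + w) ^ 3 / (x\<^sub>n * - den (- w))"
      by blast
    ultimately show ?thesis
      by linarith
  qed
  show ?thesis
  proof (rule expanding_ray_in_basin[of "{v. v \<le> - crit}" "101/100" u "- crit"])
    fix v assume "v \<in> {v. v \<le> - crit}"
    then have v: "- v \<ge> crit" by simp
    show "den v \<noteq> 0" "\<bar>scale v\<bar> \<ge> 101/100"
      using neg[OF v] large[OF v] by auto
    have "1 \<le> \<bar>scale v\<bar> ^ n"
      using large[OF v] by (intro one_le_power) auto
    then have "1 \<le> scale v ^ n"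
      using even by (simp add: power_even_abs)
    then have "- v * 1 \<le> - v * scale v ^ n"
      using v critical_value_factor(3) by (intro mult_left_mono) auto
    then show "v * scale v ^ n \<in> {v. v \<le> - crit}"
      using v by simp
  qed (use u critical_value_factor in auto)
qed

lemma critical_image_odd:
  assumes u: "u ^ n = of_real (- crit)" and odd: "odd n"
  shows "f u ^ n = of_real (crit * crit_scale ^ n)" "R (chart u) = chart (f u)"
proof -
  have "- crit * scale (- crit) ^ n = crit * crit_scale ^ n"
    using odd by (simp add: critical_value_factor)
  then show "f u ^ n = of_real (crit * crit_scale ^ n)" "R (chart u) = chart (f u)"
    using f_on_ray(3,4)[OF u] critical_value_factor(1) by auto
qed

text \<open>
  For odd \<open>n\<close> the critical values lie on rays through roots of unity. If \<open>n \<le> 15\<close>, their \<open>n\<close>-th power is at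
  least \<open>10 * (n + 1)\<close>, and from there on \<open>scale\<close> stays above \<open>21/20\<close>.
\<close>

lemma critical_odd_small:
  assumes u: "u ^ n = of_real (- crit)" and odd: "odd n" and small: "n \<le> 15"
  shows "chart u \<in> basin R (Fin 0)"
proof -
  have "n \<ge> 3"
    using n odd by presburger
  then have x: "x\<^sub>n \<ge> 3" "x\<^sub>n \<le> 15"
    using small by auto
  have neg: "den v < 0" and large: "scale v \<ge> 21/20" if v: "v \<ge> 10 * (x\<^sub>n + 1)" for v
  proof -
    have v0: "v > 0" using v x by simp
    have v2: "10 * ((x\<^sub>n + 1) * v) \<le> v\<^sup>2"
      using mult_right_mono[OF v, of v] v0 by (simp only: power2_eq_square mult.assoc)
    have den: "den v = (x\<^sub>n + 1) * (2 * x\<^sub>n + 1) - 2 * ((x\<^sub>n + 1) * v) - (x\<^sub>n - 1) * v\<^sup>2"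
      by (simp only: den_def mult.assoc)
    have a: "(x\<^sub>n + 1) * (2 * x\<^sub>n + 1) \<le> (x\<^sub>n + 1) * v" "0 \<le> (x\<^sub>n + 1) * (2 * x\<^sub>n + 1)"
      using v x by (auto intro!: mult_left_mono)
    have "0 < (x\<^sub>n + 1) * v" "0 \<le> (x\<^sub>n - 1) * v\<^sup>2"
      using v0 x by auto
    then show neg: "den v < 0"
      using a unfolding den by linarith
    have "- den v \<le> (x\<^sub>n - 1) * v\<^sup>2 + 1/5 * v\<^sup>2"
      using v2 a unfolding den by linarith
    then have "x\<^sub>n * - den v \<le> x\<^sub>n * ((x\<^sub>n - 4/5) * v\<^sup>2)"
      using x by (intro mult_left_mono) (auto simp: algebra_simps)
    then have "21/20 * (x\<^sub>n * - den v) \<le> 21/20 * (x\<^sub>n * ((x\<^sub>n - 4/5) * v\<^sup>2))"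
      by (rule mult_left_mono) simp
    also have "21/20 * (x\<^sub>n * ((x\<^sub>n - 4/5) * v\<^sup>2)) \<le> 2 * (v - (x\<^sub>n + 1)) ^ 3"
    proof -
      have "21/20 * (x\<^sub>n * (x\<^sub>n - 4/5)) \<le> 729/50 * (x\<^sub>n + 1)"
      proof -
        have "x\<^sub>n * x\<^sub>n \<le> x\<^sub>n * 15"
          using x by (intro mult_left_mono) auto
        then show ?thesis
          using x by argo
      qed
      then have "21/20 * (x\<^sub>n * (x\<^sub>n - 4/5)) * v\<^sup>2 \<le> 729/50 * (x\<^sub>n + 1) * v\<^sup>2"
        by (rule mult_right_mono) simp
      also have "\<dots> = 729/500 * (10 * (x\<^sub>n + 1)) * v\<^sup>2"
        by simp
      also have "\<dots> \<le> 729/500 * v * v\<^sup>2"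
        using v by (intro mult_right_mono mult_left_mono) auto
      also have "\<dots> = 2 * (9/10 * v) ^ 3"
        by (simp add: power2_eq_square power3_eq_cube)
      also have "\<dots> \<le> 2 * (v - (x\<^sub>n + 1)) ^ 3"
        using v v0 by (intro mult_left_mono power_mono) auto
      finally show ?thesis
        by (simp add: mult.assoc)
    qed
    finally have "21/20 * (x\<^sub>n * - den v) \<le> 2 * (v - (x\<^sub>n + 1)) ^ 3" .
    moreover have "x\<^sub>n * - den v > 0"
      using neg x by (intro mult_pos_pos) auto
    ultimately have "21/20 \<le> 2 * (v - (x\<^sub>n + 1)) ^ 3 / (x\<^sub>n * - den v)"
      using pos_le_divide_eq by blast
    also have "\<dots> = scale v"
    proof -
      have "(x\<^sub>n + 1 - v) ^ 3 = - ((v - (x\<^sub>n + 1)) ^ 3)"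
        by (simp add: power3_eq_cube algebra_simps)
      then show ?thesis
        by (simp add: scale_def)
    qed
    finally show "scale v \<ge> 21/20" .
  qed
  \<comment> \<open>For each \<open>n\<close> a convenient rational lower bound \<open>r\<close> of \<open>crit_scale\<close> is enough.\<close>
  have scale_power: "5 \<le> crit_scale ^ n"
    if "n = k" "r \<le> 27 * (real k + 1)\<^sup>2 / ((real k - 1)\<^sup>2 * (2 * real k + 1))" "0 \<le> r" "5 \<le> r ^ k"
    for k r
  proof -
    have "r \<le> crit_scale"
      unfolding crit_scale_def using that by simp
    then have "r ^ n \<le> crit_scale ^ n"
      using that by (intro power_mono)
    then show ?thesis
      using that by simp
  qed
  have "n = 3 \<or> n = 5 \<or> n = 7 \<or> n = 9 \<or> n = 11 \<or> n = 13 \<or> n = 15"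
    using n odd small by presburger
  then have "5 \<le> crit_scale ^ n"
  proof (elim disjE)
    assume "n = 3" then show ?thesis
      by (rule scale_power[of 3 15]) (simp_all add: power2_eq_square)
  next
    assume "n = 5" then show ?thesis
      by (rule scale_power[of 5 5]) (simp_all add: power2_eq_square)
  next
    assume "n = 7" then show ?thesis
      by (rule scale_power[of 7 3]) (simp_all add: power2_eq_square)
  next
    assume "n = 9" then show ?thesis
      by (rule scale_power[of 9 2]) (simp_all add: power2_eq_square)
  next
    assume "n = 11" then show ?thesis
      by (rule scale_power[of 11 "3/2"]) (simp_all add: power2_eq_square power_divide)
  next
    assume "n = 13" then show ?thesis
      by (rule scale_power[of 13 "5/4"]) (simp_all add: power2_eq_square power_divide)
  next
    assume "n = 15" then show ?thesis
      by (rule scale_power[of 15 "113/100"]) (simp_all add: power2_eq_square power_divide)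
  qed
  moreover have "2 * (x\<^sub>n + 1) \<le> crit"
  proof -
    have "(x\<^sub>n + 1) * (2 * (x\<^sub>n - 1)) \<le> (x\<^sub>n + 1) * (2 * x\<^sub>n + 1)"
      by (rule mult_left_mono) simp_all
    then have "2 * (x\<^sub>n + 1) * (x\<^sub>n - 1) \<le> (x\<^sub>n + 1) * (2 * x\<^sub>n + 1)"
      by (simp only: mult_ac)
    moreover have "0 < x\<^sub>n - 1"
      using x by simp
    ultimately show ?thesis
      unfolding crit_def using pos_le_divide_eq by blast
  qed
  ultimately have "2 * (x\<^sub>n + 1) * 5 \<le> crit * crit_scale ^ n"
    using critical_value_factor(3,4) by (intro mult_mono) auto
  then have start: "10 * (x\<^sub>n + 1) \<le> crit * crit_scale ^ n"
    by simp
  have "chart (f u) \<in> basin R (Fin 0)"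
  proof (rule expanding_ray_in_basin[of "{v. v \<ge> 10 * (x\<^sub>n + 1)}" "21/20" _ "crit * crit_scale ^ n"])
    fix v assume "v \<in> {v. v \<ge> 10 * (x\<^sub>n + 1)}"
    then have v: "v \<ge> 10 * (x\<^sub>n + 1)" by simp
    show "den v \<noteq> 0" "\<bar>scale v\<bar> \<ge> 21/20"
      using neg[OF v] large[OF v] by auto
    have "1 \<le> scale v ^ n"
      using large[OF v] by (intro one_le_power) auto
    then have "v * 1 \<le> v * scale v ^ n"
      using v x by (intro mult_left_mono) auto
    with v show "v * scale v ^ n \<in> {v. v \<ge> 10 * (x\<^sub>n + 1)}"
      unfolding mem_Collect_eq mult_1_right by (rule order_trans)
  qed (use start x critical_image_odd[OF u odd] in auto)
  then show ?thesis
    using critical_image_odd(2)[OF u odd] basin_image_iff[of R "chart u"] by simp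
qed

lemma den_cofactor_positive:
  assumes "n \<ge> 17" "0 < v" "v \<le> 5/2"
  shows "den v > 0 \<and> cofactor v > 0"
proof -
  have x: "x\<^sub>n \<ge> 17" using assms(1) by simp
  have sq: "17 * x\<^sub>n \<le> x\<^sub>n * x\<^sub>n"
    using x by (intro mult_right_mono) auto
  have qb: "2 * (x\<^sub>n + 1) * v \<le> 2 * (x\<^sub>n + 1) * (5/2)"
    by (rule mult_left_mono[OF assms(3)]) simp
  have "v\<^sup>2 \<le> 25/4"
    using power_mono[of v "5/2" 2] assms by (simp add: power2_eq_square)
  then have "(x\<^sub>n - 1) * v\<^sup>2 \<le> (x\<^sub>n - 1) * (25/4)"
    using x by (intro mult_left_mono) auto
  with qb have "den v \<ge> (x\<^sub>n + 1) * (2 * x\<^sub>n + 1) - 2 * (x\<^sub>n + 1) * (5/2) - (x\<^sub>n - 1) * (25/4)"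
    unfolding den_def by (intro diff_mono order_refl)
  also have "(x\<^sub>n + 1) * (2 * x\<^sub>n + 1) - 2 * (x\<^sub>n + 1) * (5/2) - (x\<^sub>n - 1) * (25/4)
      = 2 * (x\<^sub>n * x\<^sub>n) - 33/4 * x\<^sub>n + 9/4"
    by (simp add: field_simps)
  finally have "den v > 0"
    using x sq by linarith
  have "(x\<^sub>n + 1) * (x\<^sub>n + 4) * v \<le> (x\<^sub>n + 1) * (x\<^sub>n + 4) * (5/2)"
    by (rule mult_left_mono[OF assms(3)]) simp
  then have "cofactor v \<ge> 0 - (x\<^sub>n + 1) * (x\<^sub>n + 4) * (5/2) + (x\<^sub>n + 1) * (3 * x\<^sub>n + 2)"
    unfolding cofactor_def by (intro add_mono diff_mono order_refl) simp
  also have "0 - (x\<^sub>n + 1) * (x\<^sub>n + 4) * (5/2) + (x\<^sub>n + 1) * (3 * x\<^sub>n + 2)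
      = 1/2 * (x\<^sub>n * x\<^sub>n) - 15/2 * x\<^sub>n - 8"
    by (simp add: algebra_simps)
  finally have "cofactor v > 0"
    using x sq by linarith
  with \<open>den v > 0\<close> show ?thesis ..
qed

text \<open>
  For \<open>n \<ge> 19\<close> the factor \<open>crit_scale ^ n\<close> is so small that the \<open>n\<close>-th power of the critical value is at most
  \<open>5/2\<close>, inside the interval that is attracted to \<open>1\<close>. The numbers \<open>10/9\<close> and \<open>100/117\<close> are the values of
  \<open>(n + 1) / (n - 1)\<close> and \<open>crit_scale\<close> at \<open>n = 19\<close>, where both are largest.
\<close>

lemma critical_odd_large:
  assumes u: "u ^ n = of_real (- crit)" and odd: "odd n" and large: "n \<ge> 19"
  shows "\<exists>\<zeta>. \<zeta> ^ n = 1 \<and> chart u \<in> basin R (chart \<zeta>)"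
proof -
  have x: "x\<^sub>n \<ge> 19" using large by simp
  have ratio: "(x\<^sub>n + 1) / (x\<^sub>n - 1) \<le> 10/9"
    by (subst pos_divide_le_eq) (use x in auto)
  have "crit = (x\<^sub>n + 1) / (x\<^sub>n - 1) * (2 * x\<^sub>n + 1)"
    by (simp add: crit_def)
  also have "\<dots> \<le> 10/9 * (2 * x\<^sub>n + 1)"
    by (rule mult_right_mono[OF ratio]) simp
  finally have crit: "crit \<le> 10/9 * (2 * x\<^sub>n + 1)" .
  have "crit_scale = 27 * ((x\<^sub>n + 1) / (x\<^sub>n - 1))\<^sup>2 / (2 * x\<^sub>n + 1)"
    by (simp add: crit_scale_def power_divide)
  also have "\<dots> \<le> 27 * (10/9)\<^sup>2 / 39"
  proof (rule frac_le)
    have "((x\<^sub>n + 1) / (x\<^sub>n - 1))\<^sup>2 \<le> (10/9)\<^sup>2"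
      by (rule power_mono[OF ratio]) (use x in simp)
    then show "27 * ((x\<^sub>n + 1) / (x\<^sub>n - 1))\<^sup>2 \<le> 27 * (10/9)\<^sup>2"
      by (rule mult_left_mono) simp
  qed (use x in auto)
  also have "\<dots> = 100/117"
    by (simp add: power2_eq_square)
  finally have crit_scale: "crit_scale \<le> 100/117" .
  have bound: "10/9 * (2 * real k + 1) * (100/117) ^ k \<le> 5/2" if "k \<ge> 19" for k
    using that
  proof (induction k rule: dec_induct)
    case base
    show ?case by (simp add: power_divide)
  next
    case (step k)
    have "100/117 * (10/9 * (2 * real (Suc k) + 1)) \<le> 10/9 * (2 * real k + 1)"
      using step.hyps by simp
    then have "100/117 * (10/9 * (2 * real (Suc k) + 1)) * (100/117) ^ k \<le> 10/9 * (2 * real k + 1) * (100/117) ^ k"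
      by (rule mult_right_mono) simp
    also note step.IH
    finally show ?case
      by (simp only: power_Suc mult_ac)
  qed
  have "crit * crit_scale ^ n \<le> 10/9 * (2 * x\<^sub>n + 1) * (100/117) ^ n"
    using crit crit_scale critical_value_factor(4) x by (intro mult_mono power_mono) auto
  also have "\<dots> \<le> 5/2"
    by (rule bound[OF large])
  finally have "crit * crit_scale ^ n \<le> 5/2" .
  moreover have "0 < crit * crit_scale ^ n"
    using critical_value_factor(3,4) by simp
  ultimately have "\<exists>\<zeta>. \<zeta> ^ n = 1 \<and> chart (f u) \<in> basin R (chart \<zeta>)"
    using positive_ray_in_basin[of "5/2" "f u" "crit * crit_scale ^ n"] den_cofactor_positive large critical_image_odd(1)[OF u odd]
    by simp
  then show ?thesis
    using critical_image_odd(2)[OF u odd] basin_image_iff[of R "chart u"] by simp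
qed

text \<open>
  For \<open>n = 17\<close> the \<open>n\<close>-th power \<open>v\<close> of the critical value overshoots the interval up to \<open>5/2\<close> that is
  attracted to \<open>1\<close>, but it lies between \<open>26\<close> and \<open>27\<close>, where \<open>scale\<close> is so small that the next image
  falls into the interval.
\<close>

lemma critical_seventeen:
  assumes u: "u ^ n = of_real (- crit)" and n17: "n = 17"
  shows "\<exists>\<zeta>. \<zeta> ^ n = 1 \<and> chart u \<in> basin R (chart \<zeta>)"
proof -
  have odd: "odd n" using n17 by simp
  have x: "x\<^sub>n = 17" using n17 by simp
  define v where "v = crit * crit_scale ^ n"
  have crit: "crit = 315/8" and crit_scale: "crit_scale = 2187/2240"
    by (simp_all add: crit_def crit_scale_def x power2_eq_square)
  have "v = 315/8 * (2187/2240) ^ 17"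
    unfolding v_def crit crit_scale by (simp only: n17)
  then have v: "26 \<le> v" "v \<le> 27"
    by (simp_all add: power_divide)
  have v2: "26 * v \<le> v\<^sup>2"
    using v by (simp add: power2_eq_square)
  have den: "den v < 0" "17 * - den v \<ge> 100000"
    using v v2 by (simp_all add: den_def x)
  have num: "0 < (v - 18) ^ 3" "(v - 18) ^ 3 \<le> 9 ^ 3"
    using power_mono[of "v - 18" 9 3] v by simp_all
  have scale: "scale v = 2 * (v - 18) ^ 3 / (17 * - den v)"
  proof -
    have "(18 - v) ^ 3 = - ((v - 18) ^ 3)"
      by (simp add: power3_eq_cube algebra_simps)
    then show ?thesis
      by (simp add: scale_def x)
  qed
  have S0: "0 < scale v"
    unfolding scale using num den by (intro divide_pos_pos) auto
  have "scale v \<le> 2 * 9 ^ 3 / 100000"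
    unfolding scale using num den by (intro frac_le) auto
  then have "scale v ^ n \<le> (1/10) ^ n"
    using S0 by (intro power_mono) auto
  then have "v * scale v ^ n \<le> 27 * (1/10) ^ n"
    using v S0 by (intro mult_mono) auto
  also have "\<dots> \<le> 5/2"
    by (simp add: n17 power_divide)
  finally have "v * scale v ^ n \<le> 5/2" .
  moreover have "0 < v * scale v ^ n"
    using v S0 by simp
  moreover have fu: "f u ^ n = of_real v"
    using critical_image_odd(1)[OF u odd] by (simp add: v_def)
  ultimately have "\<exists>\<zeta>. \<zeta> ^ n = 1 \<and> chart (f (f u)) \<in> basin R (chart \<zeta>)"
    using positive_ray_in_basin[of "5/2" "f (f u)" "v * scale v ^ n"] den_cofactor_positive n17 f_on_ray(3)[OF fu] den(1)
    by simp
  moreover have "R (chart (f u)) = chart (f (f u))"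
    using f_on_ray(4)[OF fu] den(1) by simp
  ultimately show ?thesis
    using critical_image_odd(2)[OF u odd] basin_image_iff[of R "chart u"] basin_image_iff[of R "chart (f u)"]
    by simp
qed

lemma critical_in_basin:
  assumes u: "u ^ n = of_real (- crit)" and "n \<le> 16 \<or> odd n"
  shows "chart u \<in> basin R (Fin 0) \<or> (\<exists>\<zeta>. \<zeta> ^ n = 1 \<and> chart u \<in> basin R (chart \<zeta>))"
proof -
  consider "even n" "n \<le> 16" | "odd n" "n \<le> 15" | "n = 17" | "odd n" "n \<ge> 19"
  proof -
    have "n \<le> 15 \<or> n = 16 \<or> n = 17 \<or> n = 18 \<or> n \<ge> 19" by arith
    then show thesis
      using assms(2) that by (cases "even n") auto
  qed
  then show ?thesis
    using critical_even critical_odd_small critical_seventeen critical_odd_large u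
    by cases blast+
qed

end

section \<open>Convergence of the method\<close>

theorem theorem4:
  fixes n :: nat
  assumes "n > 1" and "n \<le> 16 \<or> odd n"
  shows "convergent_for chebyshev (p_poly n)"
proof -
  interpret chebyshev_unity n
    by unfold_locales (fact assms(1))
  define Z where "Z = {\<zeta> :: complex. \<zeta> ^ n = 1}"
  have "Z \<subseteq> {\<zeta>. poly ([:0, 1:] ^ n - 1) \<zeta> = 0}"
    by (auto simp: Z_def)
  moreover have "[:0, 1 :: complex:] ^ n - 1 \<noteq> 0"
  proof
    assume "[:0, 1 :: complex:] ^ n - 1 = 0"
    then have "poly ([:0, 1 :: complex:] ^ n - 1) 0 = 0"
      by simp
    then show False
      using assms(1) by (simp add: zero_power)
  qed
  ultimately have "finite Z"
    using poly_roots_finite finite_subset by blast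
  have "fatou_set R = (\<Union>r\<in>insert (Fin 0) (chart ` Z). basin R r)"
  proof (rule fatou_set_eq_of_attracted_critical_points[OF \<open>finite Z\<close>])
    fix \<zeta> assume "\<zeta> \<in> Z"
    then have z: "\<zeta> ^ n = 1" by (simp add: Z_def)
    have Q: "poly Q \<zeta> = 2 * N ^ 3"
      unfolding poly_Q z by (simp add: algebra_simps power3_eq_cube)
    have P: "poly P \<zeta> = 2 * \<zeta> * N ^ 3"
      unfolding poly_P z by simp
    show "poly Q \<zeta> \<noteq> 0 \<and> poly P \<zeta> = \<zeta> * poly Q \<zeta> \<and> poly wronskian \<zeta> = 0"
      using assms(1) unfolding Q P poly_wronskian z by simp
  next
    have zn: "(0 :: complex) ^ n = 0"
      using assms(1) by (simp add: zero_power)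
    show "poly P 0 = 0"
      by (simp add: poly_P)
    have Q: "poly Q 0 = of_real (x\<^sub>n * ((x\<^sub>n + 1) * (2 * x\<^sub>n + 1)))"
      unfolding poly_Q zn by simp
    have x: "x\<^sub>n \<ge> 2" by (rule n_real_ge_2)
    show Q0: "poly Q 0 \<noteq> 0"
      unfolding Q using x by (simp only: of_real_eq_0_iff) simp
    have "poly wronskian 0 = poly (pderiv P) 0 * poly Q 0"
      by (simp add: wronskian_def poly_P)
    moreover have "poly wronskian 0 = of_real (2 * (x\<^sub>n + 1) ^ 3) * poly Q 0"
      unfolding poly_wronskian poly_Q zn by (simp add: power2_eq_square power3_eq_cube mult_ac)
    ultimately have dP: "poly (pderiv P) 0 = of_real (2 * (x\<^sub>n + 1) ^ 3)"
      using Q0 by (metis mult_right_cancel)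
    have "x\<^sub>n * ((x\<^sub>n + 1) * (2 * x\<^sub>n + 1)) < 2 * (x\<^sub>n + 1) ^ 3"
      using x by (simp add: algebra_simps power3_eq_cube add_pos_nonneg)
    moreover have "x\<^sub>n * ((x\<^sub>n + 1) * (2 * x\<^sub>n + 1)) > 0"
      using x by simp
    ultimately show "cmod (poly (pderiv P) 0 / poly Q 0) > 1"
      unfolding dP Q norm_divide norm_of_real by simp
  next
    fix c assume c: "poly wronskian c = 0" "poly Q c \<noteq> 0" "poly P c \<noteq> 0"
    have "c ^ n \<noteq> N + 1"
      using c(3) by (auto simp: poly_P)
    then consider "c ^ n = 1" | "(N + 1) * (2 * N + 1) + (N - 1) * c ^ n = 0"
      using c(1) assms(1) by (auto simp: poly_wronskian)
    then show "chart c \<in> (\<Union>r\<in>insert (Fin 0) (chart ` Z). basin R r)"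
    proof cases
      case 1
      have Q: "poly Q c = 2 * N ^ 3"
        unfolding poly_Q 1 by (simp add: algebra_simps power3_eq_cube)
      have P: "poly P c = 2 * c * N ^ 3"
        unfolding poly_P 1 by simp
      have "f c = c"
        using c(2) by (simp add: f_regular Q P)
      then have "chart c \<in> basin R (chart c)"
        using attracting_in_basin attracting_chart c by blast
      then show ?thesis
        using 1 by (auto simp: Z_def)
    next
      case 2
      have "c ^ n = of_real (- crit)"
      proof -
        have "of_real (x\<^sub>n - 1) * c ^ n = of_real (- ((x\<^sub>n + 1) * (2 * x\<^sub>n + 1)))"
          using 2 by (simp add: eq_neg_iff_add_eq_0 add.commute)
        then have "c ^ n = of_real (- ((x\<^sub>n + 1) * (2 * x\<^sub>n + 1))) / of_real (x\<^sub>n - 1)"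
          using n_real_ge_2 by (simp add: field_simps)
        then show ?thesis
          by (simp add: crit_def)
      qed
      from critical_in_basin[OF this assms(2)] show ?thesis
        by (auto simp: Z_def)
    qed
  qed
  moreover have "Fin ` {r. poly (p_poly n) r = 0} = insert (Fin 0) (chart ` Z)"
  proof -
    have "chart ` Z = Fin ` {r. r ^ n = 1}"
    proof (intro equalityI subsetI)
      fix p assume "p \<in> chart ` Z"
      then obtain \<zeta> where "\<zeta> ^ n = 1" "p = chart \<zeta>" by (auto simp: Z_def)
      then show "p \<in> Fin ` {r. r ^ n = 1}"
        using assms(1) by (auto simp: chart_def power_divide zero_power)
    next
      fix p assume "p \<in> Fin ` {r. r ^ n = 1}"
      then obtain r where r: "r ^ n = 1" "p = Fin r" by auto
      then have "r \<noteq> 0" using assms(1) by (auto simp: zero_power)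
      then have "p = chart (1 / r)" "1 / r \<in> Z"
        using r by (simp_all add: chart_def Z_def power_divide)
      then show "p \<in> chart ` Z" by blast
    qed
    moreover have "{r. poly (p_poly n) r = 0} = insert 0 {r. r ^ n = 1}"
      by (auto simp: p_poly_def)
    ultimately show ?thesis
      by simp
  qed
  ultimately have "fatou_set R = (\<Union>r\<in>Fin ` {r. poly (p_poly n) r = 0}. basin R r)"
    by (simp only:)
  then show ?thesis
    unfolding convergent_for_def R_def[symmetric] by simp
qed

end
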